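(* For every $d \geq 2$, there are exactly $2^{2d-3}$ finitely constrained subgroups of $G=\mathrm{Aut}(X^* )$ that are defined by patterns of size $d$ and have Hausdorff dimension $1 - \frac{2}{2^{d-1}}$.
   Context: Let $X=\{0,1\}$ and let $X^*$ be the set of finite words over $X$, viewed as the rooted binary tree (root the empty word, edges $w\to wx$). $X^n$ denotes the words of length $n$. $G=\mathrm{Aut}(X^* )$ is the group of automorphisms of the rooted binary tree and $G(d)=\mathrm{Aut}(X^{[d]})$ the automorphism group of the finite tree of words of length $\le d$. For $g\in G$ and $w\in X^*$ the section $g_w\in G$ is defined by $g(wv)=g(w)g_w(v)$; for $g\in G(d)$ and $|w|<d$ the finite section $g_w\in G(d-|w|)$ is defined likewise. $\pi_k$ denotes restriction of the action to words of length $\le k$ (from $G$ or from $G(n)$, $n\ge k$, to $G(k)$); for a subgroup $H$, $H(k)=\pi_k(H)$ and $H_k$ is the level-$k$ stabilizer (elements fixing every word of length $k$). A subgroup $P\le G(d)$ is an essential pattern group (of pattern size $d$) if for every $p\in P$ and $i\in\{0,1\}$ there is $q\in P$ with $\pi_{d-1}(q)=p_i$. For such $P$, $G_P=\{g\in G:\pi_d(g_w)\in P\text{ for all }w\in X^*\}$. A subgroup of $G$ is finitely constrained if it equals $G_P$ for some essential pattern group $P$; it is defined by patterns of size $d$ if $d$ is the minimal size of such a $P$. Hausdorff dimension is with respect to the profinite metric on $G$; for a closed subgroup $K$, $\mathrm{Hdim}(K)=\liminf_{n\to\infty}\log_2|K(n)|/\log_2|G(n)|$. *)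

theory Defs
  imports Complex_Main "HOL-Library.Extended_Real" "HOL-Library.Liminf_Limsup"
begin

text \<open>Words over X = {0,1} are bool lists (False = 0, True = 1).
  Tree maps are functions on words.\<close>

type_synonym word = "bool list"
type_synonym tmap = "word \<Rightarrow> word"

definition is_tree_aut :: "tmap \<Rightarrow> bool" where
  "is_tree_aut f \<longleftrightarrow> bij f \<and> f [] = [] \<and> (\<forall>w x. \<exists>y. f (w @ [x]) = f w @ [y])"

definition AutT :: "tmap set" where
  "AutT = {f. is_tree_aut f}"

text \<open>Automorphisms of the finite tree X^[d] (words of length \<le> d), represented
  as maps that are the identity on longer words.\<close>
definition is_fin_aut :: "nat \<Rightarrow> tmap \<Rightarrow> bool" where
  "is_fin_aut d f \<longleftrightarrow>
     bij_betw f {w. length w \<le> d} {w. length w \<le> d} \<and> f [] = [] \<and>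
     (\<forall>w x. length w < d \<longrightarrow> (\<exists>y. f (w @ [x]) = f w @ [y])) \<and>
     (\<forall>w. d < length w \<longrightarrow> f w = w)"

definition AutF :: "nat \<Rightarrow> tmap set" where
  "AutF d = {f. is_fin_aut d f}"

definition restr :: "nat \<Rightarrow> tmap \<Rightarrow> tmap" where
  "restr k g = (\<lambda>w. if length w \<le> k then g w else w)"

text \<open>Section g_w: g(wv) = g(w) g_w(v).\<close>
definition sect :: "tmap \<Rightarrow> word \<Rightarrow> tmap" where
  "sect g w = (\<lambda>v. drop (length w) (g (w @ v)))"

definition fsect :: "nat \<Rightarrow> tmap \<Rightarrow> word \<Rightarrow> tmap" where
  "fsect d g w = restr (d - length w) (sect g w)"

definition fin_subgroup :: "nat \<Rightarrow> tmap set \<Rightarrow> bool" where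
  "fin_subgroup d P \<longleftrightarrow> P \<subseteq> AutF d \<and> id \<in> P \<and>
     (\<forall>p\<in>P. \<forall>q\<in>P. p \<circ> q \<in> P) \<and> (\<forall>p\<in>P. inv p \<in> P)"

definition essential_pattern_group :: "nat \<Rightarrow> tmap set \<Rightarrow> bool" where
  "essential_pattern_group d P \<longleftrightarrow> 1 \<le> d \<and> fin_subgroup d P \<and>
     (\<forall>p\<in>P. \<forall>i::bool. \<exists>q\<in>P. restr (d - 1) q = fsect d p [i])"

definition G_P :: "nat \<Rightarrow> tmap set \<Rightarrow> tmap set" where
  "G_P d P = {g \<in> AutT. \<forall>w. restr d (sect g w) \<in> P}"

definition finitely_constrained :: "tmap set \<Rightarrow> bool" where
  "finitely_constrained K \<longleftrightarrow> (\<exists>d P. essential_pattern_group d P \<and> K = G_P d P)"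

definition defined_by_patterns_of_size :: "tmap set \<Rightarrow> nat \<Rightarrow> bool" where
  "defined_by_patterns_of_size K d \<longleftrightarrow>
     (\<exists>P. essential_pattern_group d P \<and> K = G_P d P) \<and>
     (\<forall>d' P. essential_pattern_group d' P \<and> K = G_P d' P \<longrightarrow> d \<le> d')"

definition hdim :: "tmap set \<Rightarrow> ereal" where
  "hdim K = liminf (\<lambda>n. ereal (log 2 (real (card (restr n ` K))) /
                               log 2 (real (card (AutF n)))))"

end

theory Submission
  imports Defs "HOL-Library.Z2"
begin

text \<open>
  Encode an automorphism by its portrait, the label in \<open>{0,1}\<close> at each word. For an essential pattern
  group \<open>P\<close> of size \<open>d\<close>, self-similarity gives \<open>|K(n+1)| = |P| (|K(n)| / |P(d-1)|)^2\<close>, so the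
  Hausdorff dimension of \<open>K = G_P\<close> is \<open>log |P_{d-1}| / 2^(d-1)\<close>; the dimension in question means
  that \<open>P_{d-1}\<close> has codimension 2 in the labels of level \<open>d-1\<close>. As the two halves of an element of
  \<open>P_{d-1}\<close> lie in \<open>P(d-1)_{d-2}\<close>, the latter has codimension 0 or 1; codimension 1 means that \<open>K\<close>
  is already defined by patterns of size \<open>d-1\<close>, and codimension 0 that \<open>P(d-1) = G(d-1)\<close>. In that case
  \<open>P_{d-1}\<close> is an invariant subspace of codimension 2, and there is just one: even label parity on
  each half. Hence \<open>P\<close> is the zero set of a cocycle with values in the permutation module of the two
  halves. On generators, the swaps at single vertices, the cocycle takes values that depend only on
  the length of the vertex and on the relative half, and the value at the root is symmetric: this
  leaves \<open>2 (d-2) + 1\<close> free bits, all of which occur.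
\<close>

section \<open>Portraits\<close>

type_synonym portrait = "word \<Rightarrow> bool"

fun act :: "portrait \<Rightarrow> word \<Rightarrow> word" where
  "act l [] = []"
| "act l (x # w) = (x \<noteq> l []) # act (\<lambda>v. l (x # v)) w"

definition psec :: "portrait \<Rightarrow> word \<Rightarrow> portrait" where
  "psec l w = (\<lambda>v. l (w @ v))"

text \<open>The label rule for a composite in which \<open>m\<close> acts first: the label of
  \<open>l\<close> is read at the image \<open>act m w\<close> of the vertex.
  \<open>act_pmul\<close> confirms that this is composition.\<close>

definition pmul :: "portrait \<Rightarrow> portrait \<Rightarrow> portrait" where
  "pmul l m = (\<lambda>w. m w \<noteq> l (act m w))"

definition pone :: portrait where
  "pone = (\<lambda>_. False)"

definition trunc :: "nat \<Rightarrow> portrait \<Rightarrow> portrait" where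
  "trunc n l = (\<lambda>w. length w < n \<and> l w)"

text \<open>The elements of \<open>G(n)\<close>, extended by trivial labels. The bound is strict
  because a label at \<open>w\<close> acts on the children of \<open>w\<close>.\<close>

definition FP :: "nat \<Rightarrow> portrait set" where
  "FP n = {l. \<forall>w. l w \<longrightarrow> length w < n}"

definition node :: "bool \<Rightarrow> (bool \<Rightarrow> portrait) \<Rightarrow> portrait" where
  "node r f = (\<lambda>w. case w of [] \<Rightarrow> r | x # v \<Rightarrow> f x v)"

lemma node_simps [simp]: "node r f [] = r" "node r f (x # v) = f x v"
  by (simp_all add: node_def)

lemma pone_apply [simp]: "\<not> pone w"
  by (simp add: pone_def)

lemma eq_pone_iff: "l = pone \<longleftrightarrow> (\<forall>w. \<not> l w)"
  by (auto simp: pone_def)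

lemma psec_Nil [simp]: "psec l [] = l"
  by (simp add: psec_def)

lemma psec_psec [simp]: "psec (psec l u) v = psec l (u @ v)"
  by (simp add: psec_def)

lemma psec_apply [simp]: "psec l u v = l (u @ v)"
  by (simp add: psec_def)

lemma psec_pone [simp]: "psec pone w = pone"
  by (simp add: eq_pone_iff psec_def)

lemma psec_node [simp]: "psec (node r f) (x # w) = psec (f x) w"
  by (rule ext) simp

lemma length_act [simp]: "length (act l w) = length w"
  by (induction l w rule: act.induct) auto

lemma act_Cons_psec: "act l (x # w) = (x \<noteq> l []) # act (psec l [x]) w"
  by (simp add: psec_def)

lemma act_append: "act l (u @ v) = act l u @ act (psec l u) v"
  by (induction l u rule: act.induct) (auto simp: psec_def)

lemma act_snoc: "act l (w @ [x]) = act l w @ [x \<noteq> l w]"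
  by (simp add: act_append)

lemma act_pone [simp]: "act pone w = w"
  by (induction w) (auto simp: pone_def)

text \<open>Only labels at proper prefixes of \<open>w\<close> matter; hence labels of length less
  than \<open>n\<close> govern the action on words of length up to and including
  \<open>n\<close>.\<close>

lemma act_cong: "(\<And>u. length u < length w \<Longrightarrow> l u = m u) \<Longrightarrow> act l w = act m w"
proof (induction w arbitrary: l m)
  case (Cons x w)
  have "act (\<lambda>v. l (x # v)) w = act (\<lambda>v. m (x # v)) w"
    by (rule Cons.IH) (simp add: Cons.prems)
  moreover have "l [] = m []" using Cons.prems[of "[]"] by simp
  ultimately show ?case by simp
qed simp

lemma act_pmul: "act (pmul l m) w = act l (act m w)"
proof (induction w rule: rev_induct)
  case (snoc x w)
  then show ?case by (simp only: act_snoc pmul_def) auto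
qed simp

lemma act_inject: "act l = act m \<Longrightarrow> l = m"
proof (rule ext)
  fix w assume "act l = act m"
  then have "act l (w @ [False]) = act m (w @ [False])" by simp
  then show "l w = m w" by (simp add: act_snoc)
qed

lemma inj_portrait_act: "inj act"
  by (rule injI) (rule act_inject)

lemma inj_act: "inj (act l)"
proof -
  have "act l u = act l v \<Longrightarrow> u = v" for u v
  proof (induction u arbitrary: l v)
    case Nil
    then show ?case by (metis length_0_conv length_act)
  next
    case (Cons x u)
    then obtain y v' where v: "v = y # v'"
      by (metis length_Suc_conv length_act)
    with Cons.prems have "x = y" by auto
    with Cons.prems v Cons.IH show ?case by auto
  qed
  then show ?thesis by (rule injI)
qed

lemma act_eq_iff [simp]: "act l u = act l v \<longleftrightarrow> u = v"
  using inj_act by (auto dest: injD)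

lemma act_onto: "\<exists>v. act l v = w"
proof (induction w arbitrary: l)
  case (Cons y w)
  obtain v where "act (\<lambda>v. l ((y \<noteq> l []) # v)) v = w" using Cons.IH by blast
  then have "act l ((y \<noteq> l []) # v) = y # w" by auto
  then show ?case by blast
qed (use act.simps(1) in blast)

lemma bij_act: "bij (act l)"
  using inj_act act_onto by (auto simp: bij_def surj_def) metis

text \<open>The condition on the length is left open, so that sums over one level and over all
  levels below a bound can both be reindexed.\<close>

lemma bij_betw_act_length: "bij_betw (act l) {w. Q (length w)} {w. Q (length w)}"
  unfolding bij_betw_def
proof
  show "inj_on (act l) {w. Q (length w)}" by (auto simp: inj_on_def)
  show "act l ` {w. Q (length w)} = {w. Q (length w)}"
    using act_onto by (auto simp: image_iff) (metis length_act)
qed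

section \<open>Group laws, sections and truncation of portraits\<close>

lemma pmul_assoc: "pmul (pmul k l) m = pmul k (pmul l m)"
  by (rule act_inject) (auto simp: act_pmul fun_eq_iff)

lemma pmul_pone [simp]: "pmul pone l = l" "pmul l pone = l"
  by (auto simp: pmul_def)

text \<open>A right inverse of the injective map \<open>act l\<close> is also a left inverse: apply
  \<open>act l\<close> once more and cancel.\<close>

lemma pmul_eq_pone_commute: "pmul l m = pone \<Longrightarrow> pmul m l = pone"
proof (rule act_inject, rule ext)
  fix w assume "pmul l m = pone"
  then have "act l (act m (act l w)) = act l w"
    by (metis act_pmul act_pone)
  then show "act (pmul m l) w = act pone w" by (simp add: act_pmul)
qed

lemma psec_pmul: "psec (pmul l m) w = pmul (psec l (act m w)) (psec m w)"
  by (rule ext) (simp add: pmul_def act_append)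

lemma trunc_trunc [simp]: "trunc n (trunc k l) = trunc (min n k) l"
  by (auto simp: trunc_def)

lemma trunc_pone [simp]: "trunc n pone = pone"
  by (simp add: eq_pone_iff trunc_def)

lemma act_trunc: "length w \<le> n \<Longrightarrow> act (trunc n l) w = act l w"
  by (rule act_cong) (simp add: trunc_def)

lemma trunc_pmul: "trunc n (pmul l m) = pmul (trunc n l) (trunc n m)"
proof (rule ext)
  fix w
  show "trunc n (pmul l m) w = pmul (trunc n l) (trunc n m) w"
    by (cases "length w < n") (auto simp: pmul_def act_trunc, auto simp: trunc_def act_trunc)
qed

lemma psec_trunc: "psec (trunc n l) w = trunc (n - length w) (psec l w)"
  by (auto simp: trunc_def fun_eq_iff)

lemma trunc_in_FP [simp]: "trunc n l \<in> FP n"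
  by (auto simp: FP_def trunc_def)

lemma trunc_FP: "l \<in> FP n \<Longrightarrow> n \<le> k \<Longrightarrow> trunc k l = l"
  by (force simp: FP_def trunc_def)

lemma FP_mono: "n \<le> k \<Longrightarrow> FP n \<subseteq> FP k"
  by (force simp: FP_def)

lemma pone_in_FP [simp]: "pone \<in> FP n"
  by (simp add: FP_def)

lemma pmul_FP: "l \<in> FP n \<Longrightarrow> m \<in> FP n \<Longrightarrow> pmul l m \<in> FP n"
  by (metis trunc_FP trunc_in_FP trunc_pmul order_refl)

lemma psec_FP: "l \<in> FP n \<Longrightarrow> psec l w \<in> FP (n - length w)"
  by (metis psec_trunc trunc_FP trunc_in_FP order_refl)

section \<open>Counting words and portraits; transitivity on levels\<close>

lemma finite_words: "finite {w :: word. length w = n}"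
  using finite_lists_length_eq[of "UNIV :: bool set" n] by simp

lemma card_words: "card {w :: word. length w = n} = 2 ^ n"
  using card_lists_length_eq[of "UNIV :: bool set" n] by simp

lemma words_less_Suc: "{w :: word. length w < Suc n} = {w. length w < n} \<union> {w. length w = n}"
  by auto

lemma finite_words_less: "finite {w :: word. length w < n}"
  by (induction n) (simp_all add: words_less_Suc finite_words)

lemma card_words_less: "card {w :: word. length w < n} = 2 ^ n - 1"
proof (induction n)
  case (Suc n)
  have "card {w :: word. length w < Suc n} = card {w :: word. length w < n} + card {w :: word. length w = n}"
    unfolding words_less_Suc
    by (rule card_Un_disjoint) (auto simp: finite_words finite_words_less)
  also have "\<dots> = 2 ^ Suc n - 1" using Suc by (simp add: card_words)
  finally show ?case .
qed simp

lemma card_preds: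
  assumes "finite A"
  shows "finite {l :: 'a \<Rightarrow> bool. \<forall>w. l w \<longrightarrow> w \<in> A}" "card {l :: 'a \<Rightarrow> bool. \<forall>w. l w \<longrightarrow> w \<in> A} = 2 ^ card A"
proof -
  have eq: "{l :: 'a \<Rightarrow> bool. \<forall>w. l w \<longrightarrow> w \<in> A} = (\<lambda>B w. w \<in> B) ` Pow A"
  proof (intro equalityI subsetI)
    fix l assume "l \<in> {l :: 'a \<Rightarrow> bool. \<forall>w. l w \<longrightarrow> w \<in> A}"
    then have "l = (\<lambda>w. w \<in> Collect l)" "Collect l \<in> Pow A" by auto
    then show "l \<in> (\<lambda>B w. w \<in> B) ` Pow A" by (rule image_eqI)
  qed auto
  have inj: "inj_on (\<lambda>B w. w \<in> B) (Pow A)"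
    by (auto simp: inj_on_def fun_eq_iff)
  show "finite {l :: 'a \<Rightarrow> bool. \<forall>w. l w \<longrightarrow> w \<in> A}" unfolding eq using assms by simp
  show "card {l :: 'a \<Rightarrow> bool. \<forall>w. l w \<longrightarrow> w \<in> A} = 2 ^ card A"
    unfolding eq by (simp add: card_image[OF inj] card_Pow assms)
qed

lemma finite_FP [simp]: "finite (FP n)" and card_FP: "card (FP n) = 2 ^ (2 ^ n - 1)"
  using card_preds[OF finite_words_less[of n]] by (simp_all add: FP_def card_words_less)

text \<open>The root label corrects the first letter, and the same \<open>h\<close> is put into both
  halves. That \<open>h\<close> has no labels from level \<open>length u\<close> on is needed when
  swaps are conjugated.\<close>

lemma act_transitive:
  "length u = length v \<Longrightarrow> \<exists>h \<in> FP (length u). act h u = v"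
proof (induction u v rule: list_induct2)
  case Nil
  show ?case by (rule bexI[of _ pone]) auto
next
  case (Cons x u y v)
  then obtain h where h: "h \<in> FP (length u)" "act h u = v" by blast
  let ?g = "node (x \<noteq> y) (\<lambda>_. h)"
  have "?g \<in> FP (length (x # u))"
    using h(1) by (auto simp: FP_def node_def split: list.splits)
  moreover have "act ?g (x # u) = y # v" using h(2) by auto
  ultimately show ?case by blast
qed

section \<open>Finite groups of portraits\<close>

text \<open>Inverses need no axiom, since \<^term>\<open>FP n\<close> is finite and \<^const>\<open>pmul\<close> is cancellative.\<close>

definition portrait_group :: "nat \<Rightarrow> portrait set \<Rightarrow> bool" where
  "portrait_group n T \<longleftrightarrow> T \<subseteq> FP n \<and> pone \<in> T \<and> (\<forall>l\<in>T. \<forall>m\<in>T. pmul l m \<in> T)"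

lemma portrait_groupD:
  assumes "portrait_group n T"
  shows "T \<subseteq> FP n" "pone \<in> T" "\<And>l m. l \<in> T \<Longrightarrow> m \<in> T \<Longrightarrow> pmul l m \<in> T" "finite T"
  using assms finite_subset[OF _ finite_FP] by (auto simp: portrait_group_def)

lemma pmul_left_cancel: "pmul l m = pmul l m' \<longleftrightarrow> m = m'"
proof
  assume eq: "pmul l m = pmul l m'"
  have "act l (act m w) = act l (act m' w)" for w
    using eq by (metis act_pmul)
  then show "m = m'" by (intro act_inject ext) simp
qed simp

lemma portrait_group_inverse:
  assumes T: "portrait_group n T" and "l \<in> T"
  obtains m where "m \<in> T" "pmul l m = pone" "pmul m l = pone"
proof -
  have "pmul l ` T = T"
    using portrait_groupD[OF T] \<open>l \<in> T\<close>
    by (intro card_subset_eq) (auto simp: card_image inj_on_def pmul_left_cancel)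
  then obtain m where "m \<in> T" "pmul l m = pone"
    using portrait_groupD(2)[OF T] by (metis imageE)
  then show ?thesis using that pmul_eq_pone_commute by blast
qed

lemma portrait_group_FP: "portrait_group n (FP n)"
  by (simp add: portrait_group_def pmul_FP)

lemma trunc_image_pmul:
  assumes "\<And>l m. l \<in> T \<Longrightarrow> m \<in> T \<Longrightarrow> pmul l m \<in> T" "l \<in> trunc k ` T" "m \<in> trunc k ` T"
  shows "pmul l m \<in> trunc k ` T"
proof -
  obtain x y where xy: "x \<in> T" "y \<in> T" "l = trunc k x" "m = trunc k y" using assms(2,3) by blast
  have "pmul l m = trunc k (pmul x y)" unfolding xy by (rule trunc_pmul[symmetric])
  then show ?thesis using assms(1) xy by blast
qed

lemma portrait_group_trunc_image:
  assumes T: "portrait_group n T"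
  shows "portrait_group k (trunc k ` T)"
  unfolding portrait_group_def
proof (intro conjI ballI)
  show "pone \<in> trunc k ` T" using portrait_groupD(2)[OF T] by (metis imageI trunc_pone)
  show "pmul l m \<in> trunc k ` T" if "l \<in> trunc k ` T" "m \<in> trunc k ` T" for l m
    using trunc_image_pmul[OF portrait_groupD(3)[OF T] that] .
qed auto

text \<open>The stabiliser of level \<open>n\<close> in \<open>T\<close>, in portrait form.\<close>

definition pkernel :: "nat \<Rightarrow> portrait set \<Rightarrow> portrait set" where
  "pkernel n T = {l \<in> T. trunc n l = pone}"

text \<open>The fibre over \<open>y\<close> is the coset of the kernel by any preimage
  \<open>h\<close> of \<open>y\<close>.\<close>

lemma card_trunc_fiber:
  assumes T: "portrait_group n T" and y: "y \<in> trunc j ` T"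
  shows "card {x \<in> T. trunc j x = y} = card (pkernel j T)"
proof -
  obtain h where h: "h \<in> T" "trunc j h = y" using y by blast
  obtain k where k: "k \<in> T" "pmul h k = pone" "pmul k h = pone"
    using portrait_group_inverse[OF T h(1)] .
  have "bij_betw (pmul h) {x \<in> T. trunc j x = pone} {x \<in> T. trunc j x = y}"
    unfolding bij_betw_def
  proof (intro conjI equalityI subsetI)
    show "inj_on (pmul h) {x \<in> T. trunc j x = pone}"
      by (simp add: inj_on_def pmul_left_cancel)
    show "z \<in> {x \<in> T. trunc j x = y}" if "z \<in> pmul h ` {x \<in> T. trunc j x = pone}" for z
      using that h portrait_groupD(3)[OF T] by (auto simp: trunc_pmul)
    fix z assume z: "z \<in> {x \<in> T. trunc j x = y}"
    have "trunc j (pmul k z) = trunc j (pmul k h)" using z h by (simp add: trunc_pmul)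
    then have "pmul k z \<in> {x \<in> T. trunc j x = pone}"
      using z k portrait_groupD(3)[OF T] by simp
    moreover have "z = pmul h (pmul k z)" using k by (simp flip: pmul_assoc)
    ultimately show "z \<in> pmul h ` {x \<in> T. trunc j x = pone}" by blast
  qed
  from bij_betw_same_card[OF this] show ?thesis by (simp add: pkernel_def)
qed

lemma card_trunc_image:
  assumes T: "portrait_group n T"
  shows "card T = card (trunc j ` T) * card (pkernel j T)"
proof -
  have "card T = (\<Sum>y \<in> trunc j ` T. card {x \<in> T. trunc j x = y})"
    using sum.group[OF portrait_groupD(4)[OF T], of "trunc j ` T" "trunc j" "\<lambda>_. 1::nat"]
      portrait_groupD(4)[OF T] by simp
  also have "\<dots> = (\<Sum>y \<in> trunc j ` T. card (pkernel j T))"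
    using card_trunc_fiber[OF T] by simp
  finally show ?thesis by simp
qed

lemma card_portrait_group_pos: "portrait_group n T \<Longrightarrow> 0 < card T"
  using portrait_groupD(2,4) card_gt_0_iff by fastforce

section \<open>Pattern groups and the groups they define\<close>

definition pattern_group :: "nat \<Rightarrow> portrait set \<Rightarrow> bool" where
  "pattern_group d S \<longleftrightarrow> 1 \<le> d \<and> portrait_group d S \<and>
     (\<forall>p\<in>S. \<forall>i. psec p [i] \<in> trunc (d - 1) ` S)"

text \<open>The portraits of the elements of \<open>G_P\<close>; \<open>G_P_eq\<close> makes this
  precise.\<close>

definition constrained :: "nat \<Rightarrow> portrait set \<Rightarrow> portrait set" where
  "constrained d S = {l. \<forall>w. trunc d (psec l w) \<in> S}"

lemma pattern_groupD:
  assumes "pattern_group d S"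
  shows "1 \<le> d" "portrait_group d S" "\<And>p i. p \<in> S \<Longrightarrow> psec p [i] \<in> trunc (d - 1) ` S"
  using assms by (auto simp: pattern_group_def)

text \<open>Essentiality extends a pattern downwards without end: below each vertex a pattern can be
  chosen that agrees with the section of the previous one on their overlap of depth
  \<open>d - 1\<close>. Thus \<open>S\<close> can be recovered from the group that it
  defines.\<close>

lemma trunc_constrained:
  assumes S: "pattern_group d S"
  shows "trunc d ` constrained d S = S"
proof (intro equalityI subsetI)
  fix p assume p: "p \<in> trunc d ` constrained d S"
  then show "p \<in> S" by (auto simp: constrained_def) (metis psec_Nil)
next
  fix p assume p: "p \<in> S"
  have "\<exists>q\<in>S. trunc (d - 1) q = psec p [i]" if "p \<in> S" for p i
    using pattern_groupD(3)[OF S that, of i] by (metis imageE)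
  then obtain e where e: "\<And>p i. p \<in> S \<Longrightarrow> e p i \<in> S \<and> trunc (d - 1) (e p i) = psec p [i]"
    by metis
  \<comment> \<open>\<open>E p w\<close> is the pattern reached from \<open>p\<close> by the choices
    along \<open>w\<close>. The portrait \<open>g\<close> below collects the root labels of these
    patterns.\<close>
  define E where "E = foldl e"
  have E: "E p w \<in> S" if "p \<in> S" for p w
    using that by (induction w arbitrary: p) (auto simp: E_def e)
  have E_label: "p v = E p v []" if "p \<in> S" "length v < d" for p v
    using that
  proof (induction v arbitrary: p)
    case (Cons i v)
    have "p (i # v) = trunc (d - 1) (e p i) v" using e[OF Cons.prems(1)] by simp
    also have "\<dots> = e p i v" using Cons.prems(2) by (simp add: trunc_def less_diff_conv)
    also have "\<dots> = E (e p i) v []" using Cons e by simp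
    finally show ?case by (simp add: E_def)
  qed (simp add: E_def)
  define g where "g = (\<lambda>w. E p w [])"
  have g: "trunc d (psec g w) = E p w" for w
  proof (rule ext)
    fix v
    have "E p (w @ v) = E (E p w) v" by (simp add: E_def)
    moreover have "E p w \<in> FP d" using E[OF p] portrait_groupD(1)[OF pattern_groupD(2)[OF S]] by blast
    ultimately show "trunc d (psec g w) v = E p w v"
      using E_label[OF E[OF p], of v w] by (auto simp: trunc_def g_def FP_def)
  qed
  have "g \<in> constrained d S" using g E[OF p] by (simp add: constrained_def)
  moreover have "p = trunc d g" using g[of "[]"] by (simp add: E_def)
  ultimately show "p \<in> trunc d ` constrained d S" by blast
qed

lemma constrained_pmul:
  assumes S: "portrait_group d S" and "l \<in> constrained d S" "m \<in> constrained d S"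
  shows "pmul l m \<in> constrained d S"
  using assms portrait_groupD(3)[OF S] by (simp add: constrained_def psec_pmul trunc_pmul)

lemma portrait_group_trunc_constrained:
  assumes S: "portrait_group d S"
  shows "portrait_group n (trunc n ` constrained d S)"
  unfolding portrait_group_def
proof (intro conjI ballI)
  have "pone \<in> constrained d S" using portrait_groupD(2)[OF S] by (simp add: constrained_def)
  then show "pone \<in> trunc n ` constrained d S" by (metis imageI trunc_pone)
  show "pmul l m \<in> trunc n ` constrained d S"
    if "l \<in> trunc n ` constrained d S" "m \<in> trunc n ` constrained d S" for l m
    using trunc_image_pmul[OF constrained_pmul[OF S] that] .
qed auto

lemma node_constrained:
  "node r f \<in> constrained d S \<longleftrightarrow> trunc d (node r f) \<in> S \<and> (\<forall>i. f i \<in> constrained d S)"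
  (is "?L \<longleftrightarrow> ?R")
proof
  assume L: ?L
  then have "trunc d (psec (node r f) (i # w)) \<in> S" for i w by (simp only: constrained_def mem_Collect_eq)
  moreover have "trunc d (psec (node r f) []) \<in> S" using L by (simp only: constrained_def mem_Collect_eq)
  ultimately show ?R by (simp add: constrained_def)
next
  assume R: ?R
  have "trunc d (psec (node r f) w) \<in> S" for w
    using R by (cases w) (simp_all add: constrained_def)
  then show ?L by (simp add: constrained_def)
qed

lemma trunc_image_trunc:
  "j \<le> n \<Longrightarrow> trunc j ` trunc n ` L = trunc j ` L"
  by (simp add: image_image min_def)

lemma psec_constrained: "l \<in> constrained d S \<Longrightarrow> psec l w \<in> constrained d S"
  by (simp add: constrained_def)

text \<open>An element of \<open>K(n+1)\<close> amounts to a root pattern \<open>p\<close> in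
  \<open>S\<close> and two sections in \<open>K(n)\<close> that match the halves of \<open>p\<close>
  down to depth \<open>d - 1\<close>. By \<open>card_trunc_fiber\<close> each section has
  \<open>f n\<close> choices, whatever \<open>p\<close> is.\<close>

lemma card_trunc_constrained_Suc:
  assumes S: "pattern_group d S" and n: "d \<le> Suc n"
  defines "K \<equiv> constrained d S"
  defines "f \<equiv> \<lambda>n. card (pkernel (d - 1) (trunc n ` K))"
  shows "card (trunc (Suc n) ` K) = card S * f n ^ 2"
proof -
  note Sg = pattern_groupD(2)[OF S] and d = pattern_groupD(1)[OF S]
  have KS: "trunc d ` K = S" using trunc_constrained[OF S] by (simp add: K_def)
  have gn: "portrait_group n (trunc n ` K)" for n
    unfolding K_def by (rule portrait_group_trunc_constrained[OF Sg])
  have img: "trunc (d - 1) ` trunc n ` K = trunc (d - 1) ` S"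
    using n trunc_image_trunc[of "d - 1" n K] trunc_image_trunc[of "d - 1" d K] KS by simp
  define A where "A = (\<lambda>p i. {x \<in> trunc n ` K. trunc (d - 1) x = psec p [i]})"
  have cA: "card (A p i) = f n" if "p \<in> S" for p i
    unfolding A_def f_def
    using pattern_groupD(3)[OF S that, of i] by (intro card_trunc_fiber[OF gn]) (simp only: img)
  have fin: "finite (A p i)" for p i
    unfolding A_def using portrait_groupD(4)[OF gn] by simp
  \<comment> \<open>The components overlap, and together they determine the element: the pattern
    supplies the root label, the sections all others.\<close>
  define \<phi> where "\<phi> = (\<lambda>x. (trunc d x, psec x [False], psec x [True]))"
  have "bij_betw \<phi> (trunc (Suc n) ` K) (Sigma S (\<lambda>p. A p False \<times> A p True))"
    unfolding bij_betw_def
  proof (intro conjI equalityI subsetI)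
    show "inj_on \<phi> (trunc (Suc n) ` K)"
    proof (intro inj_onI ext)
      fix x y w assume eq: "\<phi> x = \<phi> y"
      show "x w = y w"
      proof (cases w)
        case Nil
        have "trunc d x [] = trunc d y []" using eq by (simp add: \<phi>_def)
        then show ?thesis using d Nil by (simp add: trunc_def)
      next
        case (Cons i v)
        have "psec x [i] v = psec y [i] v" using eq by (cases i) (auto simp: \<phi>_def)
        then show ?thesis using Cons by simp
      qed
    qed
    fix z assume "z \<in> \<phi> ` trunc (Suc n) ` K"
    then obtain x where x: "x \<in> K" "z = \<phi> (trunc (Suc n) x)" by blast
    have "trunc d x \<in> S" using x(1) KS by blast
    moreover have "psec (trunc (Suc n) x) [i] \<in> A (trunc d x) i" for i
      using x(1) n psec_constrained[of x d S "[i]"]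
      by (auto simp: A_def psec_trunc K_def min_def)
    ultimately show "z \<in> Sigma S (\<lambda>p. A p False \<times> A p True)"
      using n x(2) by (simp add: \<phi>_def min_def)
  next
    fix z assume "z \<in> Sigma S (\<lambda>p. A p False \<times> A p True)"
    then obtain p x where z: "z = (p, x False, x True)" "p \<in> S" "\<And>i. x i \<in> A p i"
    proof -
      assume *: "\<And>p x. z = (p, x False, x True) \<Longrightarrow> p \<in> S \<Longrightarrow> (\<And>i. x i \<in> A p i) \<Longrightarrow> thesis"
      obtain p x0 x1 where "z = (p, x0, x1)" "p \<in> S" "x0 \<in> A p False" "x1 \<in> A p True"
        using \<open>z \<in> _\<close> by auto
      then show thesis by (intro *[of p "\<lambda>i. if i then x1 else x0"]) (auto split: if_splits)
    qed
    have "\<exists>y\<in>K. x i = trunc n y" for i using z(3)[of i] by (auto simp: A_def)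
    then obtain y where y: "\<And>i. y i \<in> K" "\<And>i. x i = trunc n (y i)" by metis
    have p_FP: "p \<in> FP d" using z(2) portrait_groupD(1)[OF Sg] by blast
    \<comment> \<open>The overlap condition is what makes the glued portrait have root pattern
      \<open>p\<close>.\<close>
    have tr: "trunc (d - 1) (y i) = psec p [i]" for i
      using z(3)[of i] n by (simp add: A_def y(2) min_absorb1 le_diff_conv)
    have eq: "trunc d (node (p []) y) = p"
    proof (rule ext)
      fix w
      show "trunc d (node (p []) y) w = p w"
      proof (cases w)
        case Nil then show ?thesis using d by (simp add: trunc_def)
      next
        case (Cons i v)
        have "trunc (d - 1) (y i) v = p (i # v)" by (simp only: tr psec_apply append.simps)
        then show ?thesis using Cons by (auto simp: trunc_def)
      qed
    qed
    have "node (p []) y \<in> K" using y z(2) by (simp add: K_def node_constrained eq[unfolded K_def])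
    moreover have "\<phi> (trunc (Suc n) (node (p []) y)) = z"
      using n eq by (simp add: \<phi>_def z(1) psec_trunc y(2) min_def)
    ultimately show "z \<in> \<phi> ` trunc (Suc n) ` K" by (metis imageI)
  qed
  then have "card (trunc (Suc n) ` K) = card (Sigma S (\<lambda>p. A p False \<times> A p True))"
    by (rule bij_betw_same_card)
  also have "\<dots> = (\<Sum>p\<in>S. card (A p False \<times> A p True))"
    using portrait_groupD(4)[OF Sg] fin by (intro card_SigmaI) auto
  also have "\<dots> = card S * f n ^ 2"
    using cA by (simp add: card_cartesian_product power2_eq_square)
  finally show ?thesis .
qed

section \<open>Portraits represent tree automorphisms\<close>

definition fin_act :: "nat \<Rightarrow> portrait \<Rightarrow> tmap" where
  "fin_act d l = restr d (act l)"

lemma AutT_eq: "AutT = range act"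
proof (intro equalityI subsetI)
  fix f assume "f \<in> AutT"
  then have bij: "bij f" and Nil: "f [] = []" and ext: "\<And>w x. \<exists>y. f (w @ [x]) = f w @ [y]"
    by (auto simp: AutT_def is_tree_aut_def)
  \<comment> \<open>The label at \<open>w\<close> is the letter to which the child letter 0 is sent;
    injectivity forces the letter 1 to go to the other one.\<close>
  define l where "l = (\<lambda>w. last (f (w @ [False])))"
  have step: "f (w @ [x]) = f w @ [x \<noteq> l w]" for w x
  proof -
    obtain y0 y1 where y: "f (w @ [False]) = f w @ [y0]" "f (w @ [True]) = f w @ [y1]"
      using ext by metis
    have "f (w @ [False]) \<noteq> f (w @ [True])" using bij by (auto dest: bij_is_inj injD)
    then have "y0 \<noteq> y1" using y by auto
    then show ?thesis using y by (cases x) (auto simp: l_def)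
  qed
  have "f w = act l w" for w
    by (induction w rule: rev_induct) (simp_all add: Nil step act_snoc)
  then show "f \<in> range act" by auto
next
  fix f assume "f \<in> range act"
  then obtain l where "f = act l" by blast
  then show "f \<in> AutT" by (auto simp: AutT_def is_tree_aut_def bij_act act_snoc)
qed

lemma fin_act_apply: "fin_act d l w = (if length w \<le> d then act l w else w)"
  by (simp add: fin_act_def restr_def)

lemma fin_act_trunc: "d \<le> n \<Longrightarrow> fin_act d (trunc n l) = fin_act d l"
  by (auto simp: fin_act_apply act_trunc)

lemma fin_act_inject:
  assumes "fin_act d l = fin_act d m"
  shows "trunc d l = trunc d m"
proof (rule ext)
  fix w
  show "trunc d l w = trunc d m w"
    using fun_cong[OF assms, of "w @ [False]"]
    by (auto simp: fin_act_apply act_snoc trunc_def split: if_splits)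
qed

lemma fin_act_eq_iff: "fin_act d l = fin_act d m \<longleftrightarrow> trunc d l = trunc d m"
  using fin_act_inject fin_act_trunc by (metis order_refl)

lemma inj_on_fin_act: "inj_on (fin_act d) (FP d)"
  by (intro inj_onI) (metis fin_act_inject trunc_FP order_refl)

lemma AutF_eq: "AutF d = fin_act d ` FP d"
proof (intro equalityI subsetI)
  fix f assume "f \<in> AutF d"
  then have bij: "bij_betw f {w. length w \<le> d} {w. length w \<le> d}" and Nil: "f [] = []"
    and ext: "\<And>w x. length w < d \<Longrightarrow> \<exists>y. f (w @ [x]) = f w @ [y]"
    and long: "\<And>w. d < length w \<Longrightarrow> f w = w"
    by (auto simp: AutF_def is_fin_aut_def)
  define l where "l = (\<lambda>w. last (f (w @ [False])))"
  have step: "f (w @ [x]) = f w @ [x \<noteq> l w]" if w: "length w < d" for w x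
  proof -
    obtain y0 y1 where y: "f (w @ [False]) = f w @ [y0]" "f (w @ [True]) = f w @ [y1]"
      using ext[OF w, of False] ext[OF w, of True] by blast
    have "f (w @ [False]) \<noteq> f (w @ [True])"
      using inj_onD[OF bij_betw_imp_inj_on[OF bij], of "w @ [False]" "w @ [True]"] w by auto
    then have "y0 \<noteq> y1" using y by auto
    then show ?thesis using y by (cases x) (auto simp: l_def)
  qed
  have "length w \<le> d \<Longrightarrow> f w = act l w" for w
    by (induction w rule: rev_induct) (simp_all add: Nil step act_snoc)
  then have "f = fin_act d (trunc d l)"
    by (auto simp: fin_act_trunc fin_act_apply long)
  then show "f \<in> fin_act d ` FP d" by auto
next
  fix f assume "f \<in> fin_act d ` FP d"
  then obtain l where f: "f = fin_act d l" by blast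
  have "bij_betw f {w. length w \<le> d} {w. length w \<le> d}"
    using bij_betw_act_length[of l "\<lambda>n. n \<le> d"]
    by (rule bij_betw_cong[THEN iffD1, rotated]) (simp add: f fin_act_apply)
  then show "f \<in> AutF d"
    by (auto simp: AutF_def is_fin_aut_def f fin_act_apply act_snoc)
qed

lemma card_AutF: "card (AutF n) = 2 ^ (2 ^ n - 1)"
  by (simp add: AutF_eq card_image inj_on_fin_act card_FP)

lemma fin_act_pone: "fin_act d pone = id"
  by (auto simp: fin_act_apply)

lemma fin_act_pmul: "fin_act d l \<circ> fin_act d m = fin_act d (pmul l m)"
  by (auto simp: fin_act_apply act_pmul fun_eq_iff)

lemma inv_fin_act: "pmul l m = pone \<Longrightarrow> inv (fin_act d l) = fin_act d m"
  by (rule inv_unique_comp) (simp_all add: fin_act_pmul pmul_eq_pone_commute fin_act_pone)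

lemma fsect_fin_act: "1 \<le> d \<Longrightarrow> fsect d (fin_act d l) [i] = fin_act (d - 1) (psec l [i])"
  by (auto simp: fsect_def restr_def sect_def fin_act_apply psec_def fun_eq_iff)

lemma restr_sect_act: "restr d (sect (act l) w) = fin_act d (trunc d (psec l w))"
  by (simp add: fin_act_trunc) (auto simp: fin_act_apply restr_def sect_def act_append fun_eq_iff)

lemma restr_fin_act: "k \<le> d \<Longrightarrow> restr k (fin_act d l) = fin_act k l"
  by (auto simp: restr_def fin_act_apply fun_eq_iff)

section \<open>Translation of pattern groups into sets of portraits\<close>

lemma fin_subgroup_iff:
  assumes "S \<subseteq> FP d"
  shows "fin_subgroup d (fin_act d ` S) \<longleftrightarrow> portrait_group d S"
proof -
  have mem: "fin_act d l \<in> fin_act d ` S \<longleftrightarrow> l \<in> S" if "l \<in> FP d" for l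
    using inj_on_image_mem_iff[OF inj_on_fin_act that assms] .
  show ?thesis
  proof
    assume P: "fin_subgroup d (fin_act d ` S)"
    have "pone \<in> S" using P mem[of pone] by (simp add: fin_subgroup_def fin_act_pone)
    moreover have "pmul l m \<in> S" if "l \<in> S" "m \<in> S" for l m
      using P mem[of "pmul l m"] that assms pmul_FP
      by (auto simp: fin_subgroup_def fin_act_pmul subset_iff)
    ultimately show "portrait_group d S" using assms by (simp add: portrait_group_def)
  next
    assume S: "portrait_group d S"
    have "inv (fin_act d l) \<in> fin_act d ` S" if l: "l \<in> S" for l
    proof -
      obtain m where "m \<in> S" "pmul l m = pone" using portrait_group_inverse[OF S l] .
      then show ?thesis using inv_fin_act by blast
    qed
    moreover have "id \<in> fin_act d ` S"
      using portrait_groupD(2)[OF S] by (metis fin_act_pone imageI)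
    ultimately show "fin_subgroup d (fin_act d ` S)"
      using assms portrait_groupD(3)[OF S]
      by (auto simp: fin_subgroup_def fin_act_pmul AutF_eq)
  qed
qed

lemma essential_pattern_group_iff:
  assumes SF: "S \<subseteq> FP d"
  shows "essential_pattern_group d (fin_act d ` S) \<longleftrightarrow> pattern_group d S"
proof -
  have "(\<exists>q\<in>fin_act d ` S. restr (d - 1) q = fsect d (fin_act d p) [i])
      \<longleftrightarrow> psec p [i] \<in> trunc (d - 1) ` S" if "1 \<le> d" "p \<in> S" for p i
  proof -
    have "psec p [i] \<in> FP (d - 1)" using psec_FP[of p d "[i]"] SF that by auto
    then have "trunc (d - 1) (psec p [i]) = psec p [i]" by (simp add: trunc_FP)
    then show ?thesis using that
      by (simp add: fsect_fin_act restr_fin_act fin_act_eq_iff image_iff eq_commute[of "psec p [i]"])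
  qed
  then show ?thesis
    unfolding essential_pattern_group_def pattern_group_def fin_subgroup_iff[OF SF]
    by (auto simp: ball_simps)
qed

lemma essential_pattern_group_portraits:
  assumes "essential_pattern_group d P"
  obtains S where "pattern_group d S" "P = fin_act d ` S"
proof -
  have "P \<subseteq> fin_act d ` FP d"
    using assms by (auto simp: essential_pattern_group_def fin_subgroup_def AutF_eq)
  then obtain S where "S \<subseteq> FP d" "P = fin_act d ` S" by (meson subset_imageE)
  then show ?thesis using that assms essential_pattern_group_iff by blast
qed

lemma pattern_group_FP: "pattern_group d S \<Longrightarrow> S \<subseteq> FP d"
  using pattern_groupD(2) portrait_groupD(1) by blast

lemma G_P_eq:
  assumes "S \<subseteq> FP d"
  shows "G_P d (fin_act d ` S) = act ` constrained d S"
proof -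
  have "fin_act d (trunc d (psec l w)) \<in> fin_act d ` S \<longleftrightarrow> trunc d (psec l w) \<in> S" for l w
    using inj_on_image_mem_iff[OF inj_on_fin_act trunc_in_FP assms] .
  then show ?thesis
    by (auto simp: G_P_def AutT_eq restr_sect_act constrained_def)
qed

lemma finitely_constrained_size_iff:
  "(\<exists>P. essential_pattern_group d P \<and> K = G_P d P) \<longleftrightarrow>
   (\<exists>S. pattern_group d S \<and> K = act ` constrained d S)"
  by (metis G_P_eq essential_pattern_group_iff essential_pattern_group_portraits pattern_group_FP)

lemma card_restr_act: "card (restr n ` act ` L) = card (trunc n ` L)"
proof -
  have "restr n ` act ` L = fin_act n ` trunc n ` L"
    by (simp add: image_image fin_act_trunc) (simp add: fin_act_def)
  moreover have "inj_on (fin_act n) (trunc n ` L)"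
    using inj_on_fin_act by (rule inj_on_subset) auto
  ultimately show ?thesis by (simp add: card_image)
qed

section \<open>The Hausdorff dimension\<close>

text \<open>The shape of \<open>log |K(n)| / log |G(n)|\<close> for \<open>n = m + (d - 1)\<close>,
  with \<open>D = 2 ^ (d - 1)\<close>.\<close>

lemma tendsto_affine_ratio:
  fixes A C D :: real
  assumes "D \<ge> 1"
  shows "(\<lambda>m. (2 ^ m * A - C) / (2 ^ m * D - 1)) \<longlonglongrightarrow> A / D"
proof -
  have half: "(\<lambda>m. (1 / 2) ^ m * c) \<longlonglongrightarrow> 0 * c" for c :: real
    by (intro tendsto_intros LIMSEQ_realpow_zero) auto
  have "(\<lambda>m. (A - (1 / 2) ^ m * C) / (D - (1 / 2) ^ m * 1)) \<longlonglongrightarrow> (A - 0 * C) / (D - 0 * 1)"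
    using assms by (intro tendsto_intros half) auto
  moreover have "(A - (1 / 2) ^ m * C) / (D - (1 / 2) ^ m * 1) = (2 ^ m * A - C) / (2 ^ m * D - 1)" for m :: nat
  proof -
    have "(2 ^ m * A - C) / (2 ^ m * D - 1) = (2 ^ m * (A - (1 / 2) ^ m * C)) / (2 ^ m * (D - (1 / 2) ^ m * 1))"
      by (simp add: right_diff_distrib power_one_over)
    then show ?thesis by simp
  qed
  ultimately show ?thesis by simp
qed

text \<open>In logarithms the recursion for the orders is \<open>x\<close> to
  \<open>2 * x + s - 2 * q\<close>. Its fixed point is \<open>2 * q - s\<close>, and it starts at
  \<open>q\<close> on level \<open>d - 1\<close>.\<close>

lemma log_card_trunc_constrained:
  assumes S: "pattern_group d S"
  defines "q \<equiv> log 2 (card (trunc (d - 1) ` S))" and "s \<equiv> log 2 (card S)"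
  shows "log 2 (card (trunc (m + (d - 1)) ` constrained d S)) = 2 ^ m * (s - q) - (s - 2 * q)"
proof (induction m)
  case 0
  have "trunc (d - 1) ` constrained d S = trunc (d - 1) ` S"
    using trunc_image_trunc[of "d - 1" d "constrained d S"] trunc_constrained[OF S] by simp
  then show ?case by (simp add: q_def)
next
  case (Suc m)
  let ?n = "m + (d - 1)" and ?K = "constrained d S"
  define f where "f = card (pkernel (d - 1) (trunc ?n ` ?K))"
  note g = portrait_group_trunc_constrained[OF pattern_groupD(2)[OF S]]
  have "trunc (d - 1) ` trunc ?n ` ?K = trunc (d - 1) ` S"
    using trunc_image_trunc[of "d - 1" d ?K] trunc_constrained[OF S]
      trunc_image_trunc[of "d - 1" ?n ?K] by simp
  then have cn: "card (trunc ?n ` ?K) = card (trunc (d - 1) ` S) * f"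
    using card_trunc_image[OF g, of ?n "d - 1"] by (simp add: f_def)
  have cs: "card (trunc (Suc ?n) ` ?K) = card S * f ^ 2"
    unfolding f_def by (rule card_trunc_constrained_Suc[OF S]) simp
  have pos: "0 < card (trunc ?n ` ?K)" by (rule card_portrait_group_pos[OF g])
  have "0 < card S" by (rule card_portrait_group_pos[OF pattern_groupD(2)[OF S]])
  moreover have "0 < f" "0 < card (trunc (d - 1) ` S)" using cn pos by (auto intro: ccontr)
  ultimately have "log 2 (card (trunc ?n ` ?K)) = q + log 2 f"
    "log 2 (card (trunc (Suc ?n) ` ?K)) = s + 2 * log 2 f"
    by (simp_all del: One_nat_def add: cn cs log_mult log_nat_power q_def s_def)
  then show ?case using Suc by (simp add: algebra_simps)
qed

text \<open>The ratios converge, so the lower limit is the limit of the subsequence shifted by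
  \<open>d - 1\<close>.\<close>

lemma hdim_constrained:
  assumes S: "pattern_group d S"
  shows "hdim (act ` constrained d S) =
    ereal ((log 2 (card S) - log 2 (card (trunc (d - 1) ` S))) / 2 ^ (d - 1))"
proof -
  define r where "r = (\<lambda>n. log 2 (card (restr n ` act ` constrained d S)) / log 2 (card (AutF n)))"
  define q s where "q = log 2 (card (trunc (d - 1) ` S))" and "s = log 2 (card S)"
  have "r (m + (d - 1)) = (2 ^ m * (s - q) - (s - 2 * q)) / (2 ^ m * 2 ^ (d - 1) - 1)" for m
    unfolding r_def card_restr_act q_def s_def log_card_trunc_constrained[OF S]
    by (simp add: card_AutF log_nat_power of_nat_diff power_add)
  then have "(\<lambda>m. r (m + (d - 1))) \<longlonglongrightarrow> (s - q) / 2 ^ (d - 1)"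
    using tendsto_affine_ratio[of "2 ^ (d - 1)" "s - q" "s - 2 * q"] by simp
  then have "r \<longlonglongrightarrow> (s - q) / 2 ^ (d - 1)" by (rule LIMSEQ_offset)
  then have "(\<lambda>n. ereal (r n)) \<longlonglongrightarrow> ereal ((s - q) / 2 ^ (d - 1))" by simp
  then show ?thesis
    unfolding hdim_def r_def q_def s_def by (intro lim_imp_Liminf) auto
qed

lemma log2_eq_nat_iff:
  fixes x :: real
  assumes "0 < x"
  shows "log 2 x = real n \<longleftrightarrow> x = 2 ^ n"
proof
  assume "log 2 x = real n"
  then have "2 powr log 2 x = 2 powr real n" by simp
  then show "x = 2 ^ n" using assms by (simp add: powr_realpow)
qed (simp add: log_nat_power)

text \<open>The difference of logarithms is that of the kernel of truncation. The prescribed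
  dimension therefore says that this kernel has index 4 among all \<open>2 ^ 2 ^ (d - 1)\<close>
  labellings of level \<open>d - 1\<close>.\<close>

lemma hdim_constrained_iff:
  assumes S: "pattern_group d S" and d: "d \<ge> 2"
  shows "hdim (act ` constrained d S) = ereal (1 - 2 / 2 ^ (d - 1)) \<longleftrightarrow>
    card (pkernel (d - 1) S) = 2 ^ (2 ^ (d - 1) - 2)"
proof -
  let ?k = "card (pkernel (d - 1) S)"
  have c: "card S = card (trunc (d - 1) ` S) * ?k"
    by (rule card_trunc_image[OF pattern_groupD(2)[OF S]])
  have "0 < card S" by (rule card_portrait_group_pos[OF pattern_groupD(2)[OF S]])
  then have k: "0 < ?k" "0 < card (trunc (d - 1) ` S)" using c by (auto intro: ccontr)
  then have "log 2 (card S) - log 2 (card (trunc (d - 1) ` S)) = log 2 ?k"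
    by (simp add: c log_mult)
  then have "hdim (act ` constrained d S) = ereal (1 - 2 / 2 ^ (d - 1)) \<longleftrightarrow>
      log 2 ?k / 2 ^ (d - 1) = 1 - 2 / 2 ^ (d - 1)"
    using hdim_constrained[OF S] by simp
  also have "\<dots> \<longleftrightarrow> log 2 ?k = 2 ^ (d - 1) - 2" by (simp add: field_simps)
  also have "(2::real) ^ (d - 1) - 2 = real (2 ^ (d - 1) - 2)"
    using power_increasing[of 1 "d - 1" "2::nat"] d by (simp add: of_nat_diff)
  also have "log 2 ?k = real (2 ^ (d - 1) - 2) \<longleftrightarrow> real ?k = 2 ^ (2 ^ (d - 1) - 2)"
    using k by (intro log2_eq_nat_iff) simp
  also have "\<dots> \<longleftrightarrow> ?k = 2 ^ (2 ^ (d - 1) - 2)"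
    using of_nat_eq_iff[of ?k "2 ^ (2 ^ (d - 1) - 2)", where ?'a = real] by simp
  finally show ?thesis .
qed

section \<open>Kernels of truncation\<close>

definition pxor :: "portrait \<Rightarrow> portrait \<Rightarrow> portrait" where
  "pxor l m = (\<lambda>w. l w \<noteq> m w)"

lemma pxor_pxor_cancel [simp]: "pxor (pxor l m) m = l"
  by (auto simp: pxor_def)

lemma pxor_commute: "pxor l m = pxor m l"
  by (auto simp: pxor_def)

lemma pxor_FP: "l \<in> FP n \<Longrightarrow> m \<in> FP n \<Longrightarrow> pxor l m \<in> FP n"
  by (auto simp: FP_def pxor_def)

lemma trunc_pxor: "trunc n (pxor l m) = pxor (trunc n l) (trunc n m)"
  by (auto simp: pxor_def trunc_def)

lemma act_kernel: "trunc n m = pone \<Longrightarrow> length w \<le> n \<Longrightarrow> act m w = w"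
  using act_trunc[of w n m] by simp

text \<open>\<open>m\<close> fixes all words up to length \<open>n\<close>, and \<open>l\<close> has
  no labels on longer ones, so no label of \<open>l\<close> is moved. In particular the kernel is a
  vector space over the field with two elements.\<close>

lemma pmul_kernel:
  assumes "l \<in> FP (Suc n)" "trunc n m = pone"
  shows "pmul l m = pxor l m"
proof (rule ext)
  fix w
  show "pmul l m w = pxor l m w"
  proof (cases "length w \<le> n")
    case True
    then show ?thesis using act_kernel[OF assms(2)] by (auto simp: pmul_def pxor_def)
  next
    case False
    then have "\<not> l w" "\<not> l (act m w)" using assms(1) by (auto simp: FP_def)
    then show ?thesis by (simp add: pmul_def pxor_def)
  qed
qed

lemma kernel_pxor:
  assumes T: "portrait_group (Suc n) T" and "l \<in> pkernel n T" "m \<in> pkernel n T"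
  shows "pxor l m \<in> pkernel n T"
proof -
  have "pmul l m = pxor l m"
    using assms portrait_groupD(1)[OF T] by (intro pmul_kernel) (auto simp: pkernel_def)
  then show ?thesis
    using assms portrait_groupD(3)[OF T, of l m] by (simp add: pkernel_def trunc_pxor) (simp add: pxor_def pone_def)
qed

lemma pone_in_kernel: "portrait_group k T \<Longrightarrow> pone \<in> pkernel n T"
  using portrait_groupD(2) by (simp add: pkernel_def)

lemma kernel_FP: "pkernel n (FP (Suc n)) = {l. \<forall>w. l w \<longrightarrow> length w = n}"
proof -
  have "l \<in> pkernel n (FP (Suc n)) \<longleftrightarrow> (\<forall>w. l w \<longrightarrow> length w = n)" for l
    by (auto simp: pkernel_def FP_def trunc_def eq_pone_iff less_Suc_eq)
  then show ?thesis by blast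
qed

lemma card_kernel_FP: "card (pkernel n (FP (Suc n))) = 2 ^ 2 ^ n"
  using card_preds(2)[OF finite_words[of n]] by (simp add: kernel_FP card_words)

lemma kernel_mono: "S \<subseteq> T \<Longrightarrow> pkernel n S \<subseteq> pkernel n T"
  by (auto simp: pkernel_def)

lemma finite_kernel: "portrait_group k T \<Longrightarrow> finite (pkernel n T)"
  using portrait_groupD(4) by (simp add: pkernel_def)

lemma finite_kernel_FP: "finite (pkernel n (FP k))"
  by (simp add: pkernel_def)

lemma card_kernel_le:
  assumes T: "portrait_group (Suc n) T"
  shows "card (pkernel n T) \<le> 2 ^ 2 ^ n"
  using card_mono[OF finite_kernel_FP kernel_mono[OF portrait_groupD(1)[OF T]]] card_kernel_FP by metis

text \<open>A proper subspace is disjoint from its translate by any vector outside it.\<close>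

lemma card_kernel_dichotomy:
  assumes T: "portrait_group (Suc n) T"
  shows "card (pkernel n T) = 2 ^ 2 ^ n \<or> 2 * card (pkernel n T) \<le> 2 ^ 2 ^ n"
proof (cases "pkernel n T = pkernel n (FP (Suc n))")
  case True
  then show ?thesis by (simp add: card_kernel_FP)
next
  case False
  let ?B = "pkernel n T" and ?E = "pkernel n (FP (Suc n))"
  have sub: "?B \<subseteq> ?E" using portrait_groupD(1)[OF T] by (rule kernel_mono)
  then obtain a where a: "a \<in> ?E" "a \<notin> ?B" using False by blast
  have "inj_on (pxor a) ?B" by (intro inj_onI) (metis pxor_commute pxor_pxor_cancel)
  then have "card (pxor a ` ?B) = card ?B" by (rule card_image)
  moreover have "pxor a ` ?B \<subseteq> ?E"
    using a(1) sub kernel_pxor[OF portrait_group_FP] by blast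
  moreover have "?B \<inter> pxor a ` ?B = {}"
  proof (rule ccontr)
    assume "?B \<inter> pxor a ` ?B \<noteq> {}"
    then obtain b where "b \<in> ?B" "pxor a b \<in> ?B" by blast
    then have "pxor (pxor a b) b \<in> ?B" using kernel_pxor[OF T] by blast
    then show False using a(2) by simp
  qed
  ultimately have "2 * card ?B = card (?B \<union> pxor a ` ?B)"
    using finite_kernel[OF T, of n] by (simp add: card_Un_disjoint)
  also have "\<dots> \<le> card ?E"
    using sub \<open>pxor a ` ?B \<subseteq> ?E\<close> by (intro card_mono finite_kernel_FP) auto
  finally show ?thesis by (simp add: card_kernel_FP)
qed

section \<open>Lowering the pattern size by one\<close>

lemma pattern_group_trunc:
  assumes S: "pattern_group (Suc (Suc n)) S"
  shows "pattern_group (Suc n) (trunc (Suc n) ` S)"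
  unfolding pattern_group_def
proof (intro conjI ballI allI)
  show "portrait_group (Suc n) (trunc (Suc n) ` S)"
    by (rule portrait_group_trunc_image[OF pattern_groupD(2)[OF S]])
  fix p' i assume "p' \<in> trunc (Suc n) ` S"
  then obtain p where p: "p \<in> S" "p' = trunc (Suc n) p" by blast
  obtain q where q: "q \<in> S" "psec p [i] = trunc (Suc n) q"
    using pattern_groupD(3)[OF S p(1), of i] by auto
  have "psec p' [i] = trunc n (trunc (Suc n) q)"
    by (simp add: p(2) psec_trunc q(2)[symmetric])
  then show "psec p' [i] \<in> trunc (Suc n - 1) ` trunc (Suc n) ` S"
    using q(1) by (simp only: diff_Suc_1 imageI)
qed simp

abbreviation halves :: "portrait \<Rightarrow> portrait \<times> portrait" where
  "halves l \<equiv> (psec l [False], psec l [True])"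

lemma portrait_eqI:
  assumes "l [] = m []" "\<And>i. psec l [i] = psec m [i]"
  shows "l = m"
proof (rule ext)
  fix w
  show "l w = m w"
  proof (cases w)
    case (Cons i v)
    then show ?thesis using fun_cong[OF assms(2)[of i], of v] by simp
  qed (simp add: assms(1))
qed

lemma kernel_root: "trunc (Suc n) l = pone \<Longrightarrow> \<not> l []"
  by (drule fun_cong[of _ _ "[]"]) (simp add: trunc_def)

text \<open>The root label of a kernel element is trivial, so its halves determine it; essentiality
  puts each half into the kernel of the shortened pattern group.\<close>

lemma kernel_halves:
  assumes S: "pattern_group (Suc (Suc n)) S"
  defines "B \<equiv> pkernel n (trunc (Suc n) ` S)"
  shows "inj_on halves (pkernel (Suc n) S)" "halves ` pkernel (Suc n) S \<subseteq> B \<times> B"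
    "card (pkernel (Suc n) S) \<le> card B ^ 2"
proof -
  show inj: "inj_on halves (pkernel (Suc n) S)"
  proof (rule inj_onI)
    fix l m assume lm: "l \<in> pkernel (Suc n) S" "m \<in> pkernel (Suc n) S" "halves l = halves m"
    show "l = m"
    proof (rule portrait_eqI)
      show "l [] = m []" using lm kernel_root by (auto simp: pkernel_def)
      show "psec l [i] = psec m [i]" for i using lm(3) by (cases i) auto
    qed
  qed
  have "psec l [i] \<in> B" if "l \<in> pkernel (Suc n) S" for l i
  proof -
    have "trunc n (psec l [i]) = psec (trunc (Suc n) l) [i]" by (simp add: psec_trunc)
    then show ?thesis using that pattern_groupD(3)[OF S, of l i] by (simp add: B_def pkernel_def)
  qed
  then show sub: "halves ` pkernel (Suc n) S \<subseteq> B \<times> B" by blast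
  have "finite B" unfolding B_def
    by (rule finite_kernel[OF portrait_group_trunc_image[OF pattern_groupD(2)[OF S]]])
  then have "card (halves ` pkernel (Suc n) S) \<le> card (B \<times> B)" using sub by (intro card_mono) auto
  then show "card (pkernel (Suc n) S) \<le> card B ^ 2"
    by (simp add: card_image[OF inj] card_cartesian_product power2_eq_square)
qed

text \<open>A full kernel on the last level forces, through the square bound of
  \<open>kernel_halves\<close>, a full kernel one level above it. Induction makes the truncated
  group full, and comparing orders finishes.\<close>

lemma full_kernel_imp_full:
  assumes "pattern_group (Suc n) S" "card (pkernel n S) = 2 ^ 2 ^ n"
  shows "S = FP (Suc n)"
  using assms
proof (induction n arbitrary: S)
  case 0
  have "pkernel 0 S = S" by (auto simp: pkernel_def trunc_def pone_def)
  then have "card S = card (FP (Suc 0))" using 0 by (simp add: card_FP)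
  then show ?case using pattern_group_FP[OF 0(1)] by (intro card_subset_eq) auto
next
  case (Suc n)
  let ?Q = "trunc (Suc n) ` S"
  note Q = pattern_group_trunc[OF Suc.prems(1)]
  have "(2 ^ 2 ^ n)\<^sup>2 = card (pkernel (Suc n) S)" unfolding Suc.prems(2)
    by (simp flip: power_mult add: mult.commute)
  then have "(2 ^ 2 ^ n)\<^sup>2 \<le> card (pkernel n ?Q) ^ 2"
    using kernel_halves(3)[OF Suc.prems(1)] by simp
  then have "2 ^ 2 ^ n \<le> card (pkernel n ?Q)" by (rule power2_le_imp_le) simp
  then have "card (pkernel n ?Q) = 2 ^ 2 ^ n"
    using card_kernel_le[OF pattern_groupD(2)[OF Q]] by simp
  then have "?Q = FP (Suc n)" using Suc.IH[OF Q] by simp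
  then have "card S = 2 ^ (2 ^ Suc n - 1) * 2 ^ 2 ^ Suc n"
    using card_trunc_image[OF pattern_groupD(2)[OF Suc.prems(1)], of "Suc n"] Suc.prems(2)
    by (simp add: card_FP)
  also have "\<dots> = card (FP (Suc (Suc n)))" by (simp add: card_FP flip: power_add)
  finally show ?case using pattern_group_FP[OF Suc.prems(1)] by (intro card_subset_eq) auto
qed

lemma constrained_subset_trunc:
  "k \<le> d \<Longrightarrow> constrained d S \<subseteq> constrained k (trunc k ` S)"
  unfolding constrained_def
proof (intro subsetI CollectI allI)
  fix l w assume "k \<le> d" "l \<in> {l. \<forall>w. trunc d (psec l w) \<in> S}"
  then have "trunc k (trunc d (psec l w)) \<in> trunc k ` S" by blast
  then show "trunc k (psec l w) \<in> trunc k ` S" using \<open>k \<le> d\<close> by (simp add: min_def)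
qed

text \<open>Equality in the square bound means that the kernel contains every pair of admissible
  halves. The last level of a pattern then adds no condition beyond those imposed by the shorter
  patterns at the children.\<close>

lemma constrained_trunc_eq:
  assumes S: "pattern_group (Suc (Suc n)) S"
    and card: "card (pkernel (Suc n) S) = card (pkernel n (trunc (Suc n) ` S)) ^ 2"
  shows "constrained (Suc (Suc n)) S = constrained (Suc n) (trunc (Suc n) ` S)"
proof
  let ?d = "Suc (Suc n)" and ?Q = "trunc (Suc n) ` S"
  let ?B = "pkernel n ?Q"
  note Sg = pattern_groupD(2)[OF S] and Qg = pattern_groupD(2)[OF pattern_group_trunc[OF S]]
  show "constrained ?d S \<subseteq> constrained (Suc n) ?Q" by (rule constrained_subset_trunc) simp
  have onto: "halves ` pkernel (Suc n) S = ?B \<times> ?B"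
    using kernel_halves(1,2)[OF S] finite_kernel[OF Qg, of n] card
    by (intro card_subset_eq) (auto simp: card_image card_cartesian_product power2_eq_square)
  have main: "trunc ?d l \<in> S" if l: "l \<in> constrained (Suc n) ?Q" for l
  proof -
    have "trunc (Suc n) l \<in> ?Q" using l by (auto simp: constrained_def) (metis psec_Nil)
    then obtain p where p: "p \<in> S" "trunc (Suc n) p = trunc (Suc n) l" by (metis imageE)
    obtain k where k: "k \<in> S" "pmul p k = pone" "pmul k p = pone"
      using portrait_group_inverse[OF Sg p(1)] .
    \<comment> \<open>The discrepancy between the pattern of \<open>l\<close> and an element
      \<open>p\<close> of \<open>S\<close> that agrees with it above the last level. Both halves of
      \<open>r\<close> lie in \<open>?B\<close>, hence \<open>r\<close> is in
      \<open>S\<close>.\<close>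
    define r where "r = pmul (trunc ?d l) k"
    have "trunc (Suc n) r = pmul (trunc (Suc n) p) (trunc (Suc n) k)"
      by (simp add: r_def trunc_pmul p(2) min_def)
    then have r0: "trunc (Suc n) r = pone" by (simp add: k(2) flip: trunc_pmul)
    have rB: "psec r [i] \<in> ?B" for i
    proof -
      have "psec r [i] = pmul (trunc (Suc n) (psec l (act k [i]))) (psec k [i])"
        by (simp add: r_def psec_pmul psec_trunc del: act.simps)
      moreover have "trunc (Suc n) (psec l (act k [i])) \<in> ?Q"
        using l unfolding constrained_def by blast
      moreover have "psec k [i] \<in> ?Q" using pattern_groupD(3)[OF S k(1)] by simp
      ultimately have "psec r [i] \<in> ?Q" using portrait_groupD(3)[OF Qg] by metis
      moreover have "trunc n (psec r [i]) = psec (trunc (Suc n) r) [i]" by (simp add: psec_trunc)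
      ultimately show ?thesis by (simp add: pkernel_def r0)
    qed
    then have "halves r \<in> halves ` pkernel (Suc n) S" using onto by auto
    then obtain s where s: "s \<in> pkernel (Suc n) S" "halves r = halves s" by blast
    have "r = s"
    proof (rule portrait_eqI)
      show "r [] = s []" using s(1) r0 kernel_root by (auto simp: pkernel_def)
      show "psec r [i] = psec s [i]" for i using s(2) by (cases i) auto
    qed
    then have "r \<in> S" using s(1) by (simp add: pkernel_def)
    then have "pmul r p \<in> S" using p(1) portrait_groupD(3)[OF Sg] by blast
    then show ?thesis by (simp add: r_def pmul_assoc k(3))
  qed
  show "constrained (Suc n) ?Q \<subseteq> constrained ?d S"
  proof
    fix l assume "l \<in> constrained (Suc n) ?Q"
    then have "trunc ?d (psec l w) \<in> S" for w by (intro main psec_constrained)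
    then show "l \<in> constrained ?d S" by (simp add: constrained_def)
  qed
qed

text \<open>If the kernel of the shortened group is not full, its order \<open>?b\<close> is at most
  half of the maximum. Squaring turns the factor 2 into 4, the index assumed for the long kernel, so
  the square bound holds with equality.\<close>

lemma trunc_full_or_not_minimal:
  assumes S: "pattern_group (Suc (Suc n)) S"
    and card: "card (pkernel (Suc n) S) = 2 ^ (2 ^ Suc n - 2)"
  shows "trunc (Suc n) ` S = FP (Suc n) \<or>
    constrained (Suc (Suc n)) S = constrained (Suc n) (trunc (Suc n) ` S)"
proof -
  let ?Q = "trunc (Suc n) ` S"
  note Q = pattern_group_trunc[OF S]
  let ?b = "card (pkernel n ?Q)"
  show ?thesis
  proof (cases "?b = 2 ^ 2 ^ n")
    case True
    then show ?thesis using full_kernel_imp_full[OF Q] by simp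
  next
    case False
    then have "2 * ?b \<le> 2 ^ 2 ^ n" using card_kernel_dichotomy[OF pattern_groupD(2)[OF Q]] by simp
    then have "(2 * ?b) ^ 2 \<le> (2 ^ 2 ^ n) ^ 2" by (rule power_mono) simp
    also have "(2 ^ 2 ^ n) ^ 2 = (2 :: nat) ^ (2 ^ Suc n)"
      by (simp flip: power_mult add: mult.commute)
    also have "2 ^ Suc n = 2 + (2 ^ Suc n - 2 :: nat)"
      by (rule le_add_diff_inverse[symmetric]) simp
    also have "2 ^ (2 + (2 ^ Suc n - 2)) = 4 * card (pkernel (Suc n) S)" unfolding card power_add by simp
    finally have "?b ^ 2 \<le> card (pkernel (Suc n) S)" by (simp add: power_mult_distrib)
    then have "card (pkernel (Suc n) S) = ?b ^ 2" using kernel_halves(3)[OF S] by simp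
    then show ?thesis using constrained_trunc_eq[OF S] by simp
  qed
qed

section \<open>Equivariant parities\<close>

declare add_bit_eq_xor [simp del] mult_bit_eq_and [simp del]

lemma bit_add_eq_0_iff: "(a :: bit) + b = 0 \<longleftrightarrow> a = b"
  by (cases "a = 0"; cases "b = 0") simp_all

lemma of_bool_neq_bit: "of_bool (a \<noteq> b) = (of_bool a + of_bool b :: bit)"
  by (cases a; cases b) simp_all

lemma of_bool_eq_1_bit: "of_bool (a = 1) = (a :: bit)"
  by (cases "a = 0") simp_all

lemma of_bool_bit_inject: "of_bool a = (of_bool b :: bit) \<longleftrightarrow> a = b"
  by (cases a; cases b) simp_all

text \<open>A vector with two entries modulo 2, one for each half \<open>i\<close>; the weight
  decides to which entries a label at \<open>w\<close> contributes.\<close>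

definition parity :: "word set \<Rightarrow> (word \<Rightarrow> bool \<Rightarrow> bool) \<Rightarrow> portrait \<Rightarrow> bool \<Rightarrow> bit" where
  "parity A \<kappa> l i = (\<Sum>w\<in>A. of_bool (l w \<and> \<kappa> w i))"

definition equivariant :: "(word \<Rightarrow> bool \<Rightarrow> bool) \<Rightarrow> bool" where
  "equivariant \<kappa> \<longleftrightarrow> (\<forall>m w i. \<kappa> (act m w) (i \<noteq> m []) = \<kappa> w i)"

lemma parity_pxor: "parity A \<kappa> (pxor l m) i = parity A \<kappa> l i + parity A \<kappa> m i"
proof -
  have "of_bool (pxor l m w \<and> \<kappa> w i) = (of_bool (l w \<and> \<kappa> w i) + of_bool (m w \<and> \<kappa> w i) :: bit)" for w
    by (simp add: pxor_def flip: of_bool_neq_bit) auto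
  then show ?thesis by (simp add: parity_def sum.distrib)
qed

text \<open>This is the crossed homomorphism law for the permutation module of the two halves, on
  which a portrait acts by its root label. It comes from the substitution \<open>act m\<close>,
  which permutes the index set and carries the weight along.\<close>

lemma parity_pmul:
  assumes "equivariant \<kappa>"
  shows "parity {w. Q (length w)} \<kappa> (pmul l m) i =
    parity {w. Q (length w)} \<kappa> m i + parity {w. Q (length w)} \<kappa> l (i \<noteq> m [])"
proof -
  have "of_bool (pmul l m w \<and> \<kappa> w i) =
      (of_bool (m w \<and> \<kappa> w i) + of_bool (l (act m w) \<and> \<kappa> (act m w) (i \<noteq> m [])) :: bit)" for w
  proof -
    have "\<kappa> (act m w) (i \<noteq> m []) = \<kappa> w i" using assms by (simp add: equivariant_def)
    then show ?thesis by (simp add: pmul_def flip: of_bool_neq_bit) auto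
  qed
  then have "parity {w. Q (length w)} \<kappa> (pmul l m) i = parity {w. Q (length w)} \<kappa> m i +
      (\<Sum>w\<in>{w. Q (length w)}. of_bool (l (act m w) \<and> \<kappa> (act m w) (i \<noteq> m [])))"
    by (simp add: parity_def sum.distrib)
  also have "(\<Sum>w\<in>{w. Q (length w)}. of_bool (l (act m w) \<and> \<kappa> (act m w) (i \<noteq> m []))) =
      parity {w. Q (length w)} \<kappa> l (i \<noteq> m [])"
    unfolding parity_def
    by (rule sum.reindex_bij_betw[OF bij_betw_act_length, of _ m Q])
  finally show ?thesis .
qed

lemma parity_cong: "(\<And>w. w \<in> A \<Longrightarrow> l w = m w) \<Longrightarrow> parity A \<kappa> l i = parity A \<kappa> m i"
  unfolding parity_def by (rule sum.cong) auto

lemma parity_pone [simp]: "parity A \<kappa> pone i = 0"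
  by (simp add: parity_def)

lemma parity_single:
  assumes "finite A" "u \<in> A"
  shows "parity A \<kappa> (\<lambda>w. w = u) i = of_bool (\<kappa> u i)"
proof -
  have "parity A \<kappa> (\<lambda>w. w = u) i = (\<Sum>w\<in>A. if w = u then of_bool (\<kappa> u i) else 0)"
    unfolding parity_def by (rule sum.cong) auto
  then show ?thesis using assms by simp
qed

text \<open>Words of length \<open>n\<close> carry the indicator of their half, shorter words the free
  parameters. The root weight must not depend on \<open>i\<close>, since the square of the root swap is trivial.\<close>

definition weight :: "nat \<Rightarrow> (nat \<times> bool) set \<Rightarrow> word \<Rightarrow> bool \<Rightarrow> bool" where
  "weight n \<theta> w i \<longleftrightarrow> (if w = [] then (0, False) \<in> \<theta>
     else if length w = n then hd w = i else (length w, i \<noteq> hd w) \<in> \<theta>)"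

definition half_weight :: "word \<Rightarrow> bool \<Rightarrow> bool" where
  "half_weight w i \<longleftrightarrow> w \<noteq> [] \<and> hd w = i"

text \<open>Acting by \<open>m\<close> changes the first letter of a word and the index
  \<open>i\<close> by the same root label, so neither the length nor the relative half
  changes.\<close>

lemma equivariant_weight: "equivariant (weight n \<theta>)"
  unfolding equivariant_def
proof (intro allI)
  fix m w i
  show "weight n \<theta> (act m w) (i \<noteq> m []) = weight n \<theta> w i"
  proof (cases w)
    case (Cons x v)
    have "((i \<noteq> m []) \<noteq> (x \<noteq> m [])) = (i \<noteq> x)" "((x \<noteq> m []) = (i \<noteq> m [])) = (x = i)" by auto
    then show ?thesis using Cons by (simp add: weight_def)
  qed (simp add: weight_def)
qed

lemma equivariant_half_weight: "equivariant half_weight"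
  unfolding equivariant_def
proof (intro allI)
  fix m w i
  show "half_weight (act m w) (i \<noteq> m []) = half_weight w i"
    by (cases w) (auto simp: half_weight_def)
qed

section \<open>The two cocycles and their relation on the last level\<close>

definition defect :: "nat \<Rightarrow> (nat \<times> bool) set \<Rightarrow> portrait \<Rightarrow> bool \<Rightarrow> bit" where
  "defect n \<theta> = parity {w. length w < Suc n} (weight n \<theta>)"

definition half_parity :: "nat \<Rightarrow> portrait \<Rightarrow> bool \<Rightarrow> bit" where
  "half_parity n = parity {w. length w = n} half_weight"

lemma defect_pmul: "defect n \<theta> (pmul l m) i = defect n \<theta> m i + defect n \<theta> l (i \<noteq> m [])"
  unfolding defect_def using parity_pmul[OF equivariant_weight] .

lemma half_parity_pmul:
  "half_parity n (pmul l m) i = half_parity n m i + half_parity n l (i \<noteq> m [])"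
  unfolding half_parity_def using parity_pmul[OF equivariant_half_weight] .

text \<open>The parameters see only labels above level \<open>n\<close>; on level \<open>n\<close>
  the weight is the indicator of the half. The assumption keeps level \<open>n\<close> apart from
  the root, which has its own clause in \<open>weight\<close>.\<close>

lemma defect_split:
  assumes "1 \<le> n"
  shows "defect n \<theta> l i = parity {w. length w < n} (weight n \<theta>) (trunc n l) i + half_parity n l i"
proof -
  have "defect n \<theta> l i = parity {w. length w < n} (weight n \<theta>) l i + parity {w. length w = n} (weight n \<theta>) l i"
    unfolding defect_def parity_def words_less_Suc
    by (rule sum.union_disjoint) (auto simp: finite_words finite_words_less)
  also have "parity {w. length w = n} (weight n \<theta>) l i = half_parity n l i"
    unfolding half_parity_def parity_def
    using assms by (intro sum.cong) (auto simp: weight_def half_weight_def)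
  also have "parity {w. length w < n} (weight n \<theta>) l i = parity {w. length w < n} (weight n \<theta>) (trunc n l) i"
    by (rule parity_cong) (simp add: trunc_def)
  finally show ?thesis .
qed

lemma defect_trunc_single:
  assumes "1 \<le> n" "trunc n q = (\<lambda>w. w = u)" "length u < n"
  shows "defect n \<theta> q i = of_bool (weight n \<theta> u i) + half_parity n q i"
  unfolding defect_split[OF assms(1)] assms(2)
  using assms(3) by (simp add: parity_single finite_words_less)

lemma defect_kernel: "1 \<le> n \<Longrightarrow> trunc n l = pone \<Longrightarrow> defect n \<theta> l i = half_parity n l i"
  by (simp add: defect_split)

section \<open>The groups of the classification\<close>

definition defect_group :: "nat \<Rightarrow> (nat \<times> bool) set \<Rightarrow> portrait set" where
  "defect_group n \<theta> = {l \<in> FP (Suc n). \<forall>i. defect n \<theta> l i = 0}"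

definition balanced :: "nat \<Rightarrow> portrait set" where
  "balanced n = {l \<in> pkernel n (FP (Suc n)). \<forall>i. half_parity n l i = 0}"

text \<open>At most one label in each half, at the leftmost word of level \<open>n\<close> there:
  the simplest labelling with half parities prescribed by \<open>c\<close>.\<close>

definition correction :: "nat \<Rightarrow> (bool \<Rightarrow> bool) \<Rightarrow> portrait" where
  "correction n c = (\<lambda>w. length w = n \<and> tl w = replicate (n - 1) False \<and> c (hd w))"

lemma correction_kernel: "correction n c \<in> pkernel n (FP (Suc n))"
  by (simp add: kernel_FP correction_def)

lemma correction_FP: "correction n c \<in> FP (Suc n)" and trunc_correction: "trunc n (correction n c) = pone"
  using correction_kernel[of n c] by (simp_all add: pkernel_def)

lemma half_parity_correction:
  assumes "1 \<le> n"
  shows "half_parity n (correction n c) i = of_bool (c i)"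
proof -
  let ?u = "i # replicate (n - 1) False"
  have *: "correction n c w \<and> half_weight w i \<longleftrightarrow> w = ?u \<and> c i" for w
    using assms by (cases w) (auto simp: correction_def half_weight_def)
  have "half_parity n (correction n c) i = (\<Sum>w\<in>{w. length w = n}. if w = ?u then of_bool (c i) else 0)"
    unfolding half_parity_def parity_def by (rule sum.cong) (auto simp: *)
  then show ?thesis using assms by (simp add: finite_words)
qed

lemma defect_pxor_correction:
  assumes "1 \<le> n"
  shows "defect n \<theta> (pxor l (correction n c)) i = defect n \<theta> l i + of_bool (c i)"
proof -
  have "defect n \<theta> (correction n c) i = of_bool (c i)"
    using assms by (simp add: defect_kernel trunc_correction half_parity_correction)
  then show ?thesis by (simp add: defect_def parity_pxor)
qed

lemma portrait_group_defect_group: "portrait_group (Suc n) (defect_group n \<theta>)"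
  unfolding portrait_group_def defect_group_def
  by (auto simp: pmul_FP defect_pmul) (simp add: defect_def)

lemma trunc_pxor_correction: "trunc n (pxor l (correction n c)) = trunc n l"
  by (simp add: trunc_pxor trunc_correction) (simp add: pxor_def)

lemma corrected_in_defect_group:
  assumes "1 \<le> n" "l \<in> FP (Suc n)"
  shows "pxor l (correction n (\<lambda>i. defect n \<theta> l i = 1)) \<in> defect_group n \<theta>"
  using assms
  by (simp add: defect_group_def pxor_FP correction_FP defect_pxor_correction of_bool_eq_1_bit bit_add_eq_0_iff)

text \<open>Any defect can be repaired on level \<open>n\<close>, which truncation does not
  see.\<close>

lemma trunc_defect_group:
  assumes "1 \<le> n"
  shows "trunc n ` defect_group n \<theta> = FP n"
proof (intro equalityI subsetI)
  fix l assume l: "l \<in> FP n"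
  then have "l \<in> FP (Suc n)" using FP_mono[of n "Suc n"] by auto
  moreover have "l = trunc n (pxor l (correction n (\<lambda>i. defect n \<theta> l i = 1)))"
    using l by (simp add: trunc_pxor_correction trunc_FP)
  ultimately show "l \<in> trunc n ` defect_group n \<theta>"
    using corrected_in_defect_group[OF assms] by blast
qed auto

text \<open>Exactly one of the four corrections brings a given portrait into the group, since a
  correction shifts the defect by \<open>c\<close>.\<close>

lemma card_defect_group:
  assumes "1 \<le> n"
  shows "4 * card (defect_group n \<theta>) = card (FP (Suc n))"
proof -
  let ?f = "\<lambda>(s, c). pxor s (correction n c)"
  have "bij_betw ?f (defect_group n \<theta> \<times> UNIV) (FP (Suc n))"
    unfolding bij_betw_def
  proof (intro conjI equalityI subsetI)
    show "inj_on ?f (defect_group n \<theta> \<times> UNIV)"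
    proof (rule inj_onI, clarify)
      fix s c s' c'
      assume s: "s \<in> defect_group n \<theta>" "s' \<in> defect_group n \<theta>"
        and eq: "pxor s (correction n c) = pxor s' (correction n c')"
      have "of_bool (c i) = (of_bool (c' i) :: bit)" for i
        using arg_cong[OF eq, of "\<lambda>l. defect n \<theta> l i"] s assms
        by (simp add: defect_pxor_correction defect_group_def)
      then have "c = c'" by (simp add: fun_eq_iff of_bool_bit_inject)
      then show "s = s' \<and> c = c'" using eq by (metis pxor_pxor_cancel)
    qed
    show "l \<in> FP (Suc n)" if "l \<in> ?f ` (defect_group n \<theta> \<times> UNIV)" for l
      using that correction_FP pxor_FP by (auto simp: defect_group_def)
    fix l assume l: "l \<in> FP (Suc n)"
    let ?c = "\<lambda>i. defect n \<theta> l i = 1"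
    have "l = ?f (pxor l (correction n ?c), ?c)" by simp
    then show "l \<in> ?f ` (defect_group n \<theta> \<times> UNIV)"
      using corrected_in_defect_group[OF assms l] by blast
  qed
  then have "card (FP (Suc n)) = card (defect_group n \<theta> \<times> (UNIV :: (bool \<Rightarrow> bool) set))"
    by (simp add: bij_betw_same_card)
  also have "\<dots> = card (defect_group n \<theta>) * 4"
    using card_preds(2)[of "UNIV :: bool set"] by (simp add: card_cartesian_product)
  finally show ?thesis by simp
qed

lemma kernel_defect_group:
  assumes "1 \<le> n"
  shows "pkernel n (defect_group n \<theta>) = balanced n"
  using assms by (auto simp: pkernel_def balanced_def defect_group_def defect_kernel)

lemma card_balanced:
  assumes "1 \<le> n"
  shows "card (balanced n) = 2 ^ (2 ^ n - 2)"
proof -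
  have "card (FP (Suc n)) = 4 * (card (FP n) * card (balanced n))"
    \<comment> \<open>The kernel is the same for all parameters, so the empty set can serve for the
      count.\<close>
    using card_trunc_image[OF portrait_group_defect_group, of n "{}" n] card_defect_group[OF assms, of "{}"]
    by (simp add: trunc_defect_group[OF assms] kernel_defect_group[OF assms])
  moreover have "(2::nat) ^ n \<ge> 2" using power_increasing[of 1 n "2 :: nat"] assms by simp
  then obtain k where k: "(2::nat) ^ n = k + 2" by (metis le_add_diff_inverse2)
  then have "2 ^ Suc n - 1 = 2 + (2 ^ n - 1) + (2 ^ n - 2 :: nat)" by simp
  then have "card (FP (Suc n)) = 2\<^sup>2 * 2 ^ (2 ^ n - 1) * 2 ^ (2 ^ n - 2)"
    unfolding card_FP by (simp only: power_add)
  ultimately show ?thesis by (simp add: card_FP)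
qed

text \<open>Essentiality is automatic, because truncation by one level already gives all of
  \<open>FP n\<close>.\<close>

lemma pattern_group_defect_group:
  assumes "1 \<le> n"
  shows "pattern_group (Suc n) (defect_group n \<theta>)"
  unfolding pattern_group_def
proof (intro conjI ballI allI)
  fix p i assume "p \<in> defect_group n \<theta>"
  then have "psec p [i] \<in> FP n" using psec_FP[of p "Suc n" "[i]"] by (simp add: defect_group_def)
  then show "psec p [i] \<in> trunc (Suc n - 1) ` defect_group n \<theta>"
    by (simp add: trunc_defect_group[OF assms])
qed (simp_all add: portrait_group_defect_group)

text \<open>One bit for the root and two for each level \<open>k\<close> from 1 to
  \<open>n - 1\<close>: in \<open>(k, b)\<close>, \<open>b = False\<close> stands for the half
  containing the vertex and \<open>b = True\<close> for the opposite half.\<close>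

definition params :: "nat \<Rightarrow> (nat \<times> bool) set" where
  "params n = insert (0, False) ({1..<n} \<times> UNIV)"

text \<open>In the group, a lift of the swap at \<open>u\<close> must compensate the weight of
  \<open>u\<close> by its half parity, so the group determines all weights above level
  \<open>n\<close>.\<close>

lemma inj_on_defect_group:
  assumes n: "1 \<le> n"
  shows "inj_on (defect_group n) (Pow (params n))"
proof (rule inj_onI)
  fix \<theta> \<theta>' assume sub: "\<theta> \<in> Pow (params n)" "\<theta>' \<in> Pow (params n)"
    and eq: "defect_group n \<theta> = defect_group n \<theta>'"
  have w: "weight n \<theta> u i = weight n \<theta>' u i" if u: "length u < n" for u i
  proof -
    have "(\<lambda>w. w = u) \<in> FP n" using u by (simp add: FP_def)
    then obtain q where q: "q \<in> defect_group n \<theta>" "trunc n q = (\<lambda>w. w = u)"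
      using trunc_defect_group[OF n, of \<theta>] by (metis imageE)
    then have "defect n \<theta> q i = 0" "defect n \<theta>' q i = 0" using eq by (auto simp: defect_group_def)
    then have "of_bool (weight n \<theta> u i) = (of_bool (weight n \<theta>' u i) :: bit)"
      using u by (simp add: defect_trunc_single[OF n q(2)] bit_add_eq_0_iff)
    then show ?thesis by (simp only: of_bool_bit_inject)
  qed
  have "(k, b) \<in> \<theta> \<longleftrightarrow> (k, b) \<in> \<theta>'" if kb: "(k, b) \<in> params n" for k b
  proof (cases "k = 0")
    case True
    then show ?thesis using w[of "[]" False] kb n by (simp add: weight_def params_def)
  next
    case False
    then have "k < n" using kb by (auto simp: params_def)
    \<comment> \<open>The first letter of this word is 0, so the index \<open>b\<close> is also the
      relative half.\<close>
    then show ?thesis using w[of "replicate k False" b] False by (simp add: weight_def)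
  qed
  then show "\<theta> = \<theta>'" using sub by auto
qed

lemma card_params: "1 \<le> n \<Longrightarrow> card (params n) = 2 * n - 1"
  by (simp add: params_def card_cartesian_product)

section \<open>Invariant kernels of index four\<close>

text \<open>Conjugation by an element of \<open>S\<close> that acts like \<open>g\<close> up to
  level \<open>n\<close> permutes the labels of level \<open>n\<close> by \<open>g\<close>.\<close>

lemma kernel_invariant:
  assumes S: "portrait_group (Suc n) S" and full: "trunc n ` S = FP n" and l: "l \<in> pkernel n S"
  shows "(\<lambda>w. l (act g w)) \<in> pkernel n S"
proof -
  obtain p where p: "p \<in> S" "trunc n p = trunc n g"
    using full trunc_in_FP[of n g] by (metis imageE)
  obtain k where k: "k \<in> S" "pmul p k = pone" "pmul k p = pone"
    using portrait_group_inverse[OF S p(1)] .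
  have lS: "l \<in> S" "trunc n l = pone" using l by (auto simp: pkernel_def)
  define m where "m = pmul k (pmul l p)"
  have mS: "m \<in> S" unfolding m_def using lS p k portrait_groupD(3)[OF S] by blast
  have "trunc n m = trunc n (pmul k p)" by (simp add: m_def trunc_pmul lS)
  then have m0: "trunc n m = pone" by (simp add: k)
  \<comment> \<open>Comparing \<open>pmul p m\<close> with \<open>pmul l p\<close> yields the labels
    of the conjugate without those of the inverse \<open>k\<close>.\<close>
  have "pxor p m = pmul p m"
    using p(1) portrait_groupD(1)[OF S] m0 by (subst pmul_kernel) auto
  also have "\<dots> = pmul l p" by (simp add: m_def k(2) flip: pmul_assoc)
  finally have "pxor p m = pmul l p" .
  then have m: "m w = l (act p w)" for w
    by (drule_tac fun_cong[of _ _ w]) (auto simp: pxor_def pmul_def)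
  have "m = (\<lambda>w. l (act g w))"
  proof (rule ext)
    fix w
    show "m w = l (act g w)"
    proof (cases "length w \<le> n")
      case True
      then have "act p w = act g w" using p(2) by (metis act_trunc)
      then show ?thesis by (simp add: m)
    next
      case False
      moreover have "l \<in> FP (Suc n)" using lS(1) portrait_groupD(1)[OF S] by blast
      ultimately have "\<not> l (act p w)" "\<not> l (act g w)" by (auto simp: FP_def)
      then show ?thesis by (simp add: m)
    qed
  qed
  then show ?thesis using mS m0 by (simp add: pkernel_def)
qed

section \<open>Labellings supported on two words, and uniqueness of the kernel\<close>

definition pair :: "word \<Rightarrow> word \<Rightarrow> portrait" where
  "pair u v = (\<lambda>w. (w = u) \<noteq> (w = v))"

lemma pair_self: "pair u u = pone"
  by (auto simp: pair_def pone_def)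

lemma pair_trans: "pxor (pair u z) (pair v z) = pair u v"
  by (auto simp: pair_def pxor_def)

text \<open>Words in different halves can be moved independently, by \<open>h\<close> and
  \<open>h'\<close> in the respective halves.\<close>

lemma act_split_transitive:
  assumes "length s = length s'" "length t = length t'"
  shows "\<exists>g. act g (b # s) = a # s' \<and> act g ((\<not> b) # t) = (\<not> a) # t'"
proof -
  obtain h h' where h: "act h s = s'" "act h' t = t'"
    using act_transitive assms by metis
  have "act (node (a \<noteq> b) (\<lambda>i. if i = b then h else h')) (b # s) = a # s'"
    "act (node (a \<noteq> b) (\<lambda>i. if i = b then h else h')) ((\<not> b) # t) = (\<not> a) # t'"
    using h by auto
  then show ?thesis by blast
qed

text \<open>A pigeonhole argument on four words finds in the kernel a labelling supported on one or
  two words. Invariance spreads it over the tree, and differences of its images give every pair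
  inside one half.\<close>

lemma pair_in_kernel:
  assumes S: "portrait_group (Suc n) S" and full: "trunc n ` S = FP n"
    and card: "card (pkernel n S) = 2 ^ (2 ^ n - 2)"
    and x: "length x = n" and y: "length y = n" and xy: "hd x = hd y"
  shows "pair x y \<in> pkernel n S"
proof (cases "x = y")
  case True
  then show ?thesis using pone_in_kernel[OF S] by (simp add: pair_self)
next
  case False
  let ?B = "pkernel n S"
  \<comment> \<open>Distinct words with the same first letter must have a second letter.\<close>
  obtain c e s where xe: "x = c # e # s"
    using False x y xy by (cases x; cases "tl x"; cases y; auto)
  obtain f t where ye: "y = c # f # t"
    using x y xy xe by (cases y; cases "tl y"; auto)
  have len: "length s = n - 2" "length t = n - 2" and n: "2 \<le> n" using x y xe ye by auto
  have inv: "pair u v \<in> ?B" if "pair (act g u) (act g v) \<in> ?B" for g u v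
    using kernel_invariant[OF S full that, of g] by (simp add: pair_def)
  have trans: "pair u v \<in> ?B" if "pair u z \<in> ?B" "pair v z \<in> ?B" for u v z
    using kernel_pxor[OF S that] by (simp add: pair_trans)
  define r where "r = replicate (n - 2) False"
  have lr: "length r = n - 2" by (simp add: r_def)
  \<comment> \<open>One word of level \<open>n\<close> below each vertex of level 2: two of them
    first differ in the first or in the second letter, which yields the cases \<open>root\<close>
    and \<open>below\<close>.\<close>
  define U where "U = (\<lambda>(a, b). a # b # r) ` (UNIV :: (bool \<times> bool) set)"
  have cU: "card U = 4" unfolding U_def
    by (subst card_image) (auto simp: inj_on_def card_cartesian_product simp flip: UNIV_Times_UNIV)
  let ?\<phi> = "\<lambda>(u, l). pxor (\<lambda>w. w = u) l"
  have img: "?\<phi> ` (U \<times> ?B) \<subseteq> pkernel n (FP (Suc n))"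
  proof -
    have "(\<lambda>w. w = u) \<in> pkernel n (FP (Suc n))" if "u \<in> U" for u
      using that n by (auto simp: kernel_FP U_def r_def)
    then show ?thesis
      using kernel_pxor[OF portrait_group_FP] kernel_mono[OF portrait_groupD(1)[OF S], of n] by auto
  qed
  text \<open>The four words of \<open>U\<close> represent cosets of the index-four subgroup. If all four cosets are
    distinct, one of them is the subgroup itself.\<close>
  have "(\<exists>u\<in>U. (\<lambda>w. w = u) \<in> ?B) \<or> (\<exists>u\<in>U. \<exists>v\<in>U. u \<noteq> v \<and> pair u v \<in> ?B)"
  proof (cases "inj_on ?\<phi> (U \<times> ?B)")
    case True
    have "card (U \<times> ?B) = 2 ^ (2 + (2 ^ n - 2))"
      by (simp add: card_cartesian_product cU card power_add)
    also have "2 + (2 ^ n - 2 :: nat) = 2 ^ n"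
      using power_increasing[of 1 n "2 :: nat"] n by simp
    finally have "?\<phi> ` (U \<times> ?B) = pkernel n (FP (Suc n))"
      using True img by (intro card_subset_eq) (simp_all add: card_image card_kernel_FP finite_kernel_FP)
    then have "pone \<in> ?\<phi> ` (U \<times> ?B)" using pone_in_kernel[OF portrait_group_FP] by simp
    then obtain u l where ul: "u \<in> U" "l \<in> ?B" "pone = pxor (\<lambda>w. w = u) l" by auto
    have "l w = (w = u)" for w using fun_cong[OF ul(3), of w] by (auto simp: pxor_def)
    then have "l = (\<lambda>w. w = u)" by blast
    then show ?thesis using ul by blast
  next
    case False
    then obtain u l v m where uv: "u \<in> U" "v \<in> U" "l \<in> ?B" "m \<in> ?B" "(u, l) \<noteq> (v, m)"
      and eq: "pxor (\<lambda>w. w = u) l = pxor (\<lambda>w. w = v) m" by (auto simp: inj_on_def)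
    have "u \<noteq> v" using uv(5) eq by (metis pxor_commute pxor_pxor_cancel)
    moreover have "pair u v = pxor l m"
    proof (rule ext)
      fix w show "pair u v w = pxor l m w"
        using fun_cong[OF eq, of w] by (auto simp: pxor_def pair_def)
    qed
    ultimately show ?thesis using kernel_pxor[OF S uv(3,4)] uv by metis
  qed
  then have "(\<exists>u. length u = n \<and> (\<lambda>w. w = u) \<in> ?B) \<or>
      (\<exists>a b b'. pair (a # b # r) ((\<not> a) # b' # r) \<in> ?B) \<or>
      (\<exists>a b. pair (a # b # r) (a # (\<not> b) # r) \<in> ?B)"
  proof
    assume "\<exists>u\<in>U. (\<lambda>w. w = u) \<in> ?B"
    moreover have "length u = n" if "u \<in> U" for u using that lr n by (auto simp: U_def)
    ultimately show ?thesis by blast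
  next
    assume "\<exists>u\<in>U. \<exists>v\<in>U. u \<noteq> v \<and> pair u v \<in> ?B"
    then obtain a b a' b' where ab: "a \<noteq> a' \<or> b \<noteq> b'" "pair (a # b # r) (a' # b' # r) \<in> ?B"
      unfolding U_def by auto
    show ?thesis
    proof (cases "a = a'")
      case True
      then have "b' = (\<not> b)" using ab(1) by auto
      then show ?thesis using ab(2) True by blast
    next
      case False
      then have "a' = (\<not> a)" by auto
      then show ?thesis using ab(2) by blast
    qed
  qed
  then consider (single) u where "length u = n" "(\<lambda>w. w = u) \<in> ?B"
    | (root) a b b' where "pair (a # b # r) ((\<not> a) # b' # r) \<in> ?B"
    | (below) a b where "pair (a # b # r) (a # (\<not> b) # r) \<in> ?B"
    by blast
  then show ?thesis
  proof cases
    case single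
    \<comment> \<open>Transitivity on level \<open>n\<close> moves the single label to every
      word.\<close>
    have "(\<lambda>w. w = v) \<in> ?B" if v: "length v = n" for v
    proof -
      obtain g where "act g v = u" using act_transitive[of v u] single(1) v by auto
      then have "(\<lambda>w. act g w = u) = (\<lambda>w. w = v)" by auto
      then show ?thesis using kernel_invariant[OF S full single(2), of g] by simp
    qed
    then have "pxor (\<lambda>w. w = x) (\<lambda>w. w = y) \<in> ?B" using x y by (intro kernel_pxor[OF S])
    then show ?thesis by (simp add: pair_def pxor_def)
  next
    case root
    \<comment> \<open>All pairs across the two halves belong to the kernel; two words in one half
      are then joined through a word in the other.\<close>
    have R: "pair (c # u) ((\<not> c) # v) \<in> ?B" if uv: "length u = n - 1" "length v = n - 1" for u v
    proof -
      have "length u = length (b # r)" "length v = length (b' # r)" using uv lr n by auto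
      then obtain g where "act g (c # u) = a # b # r" "act g ((\<not> c) # v) = (\<not> a) # b' # r"
        using act_split_transitive[of u "b # r" v "b' # r" c a] by blast
      then show ?thesis using inv[of g "c # u" "(\<not> c) # v"] root by simp
    qed
    show ?thesis unfolding xe ye
      by (rule trans[of _ "(\<not> c) # False # r"]) (rule R; use len lr n in simp)+
  next
    case below
    \<comment> \<open>The same argument one level lower: words below one vertex of level 2 are
      joined through a word below its sibling.\<close>
    have R: "pair (c # e' # u) (c # (\<not> e') # v) \<in> ?B" if uv: "length u = n - 2" "length v = n - 2" for e' u v
    proof -
      have "length u = length r" "length v = length r" using uv lr by auto
      then obtain g where g: "act g (e' # u) = b # r" "act g ((\<not> e') # v) = (\<not> b) # r"
        using act_split_transitive[of u r v r e' b] by blast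
      let ?g = "node (a \<noteq> c) (\<lambda>_. g)"
      have "act ?g (c # e' # u) = a # b # r" "act ?g (c # (\<not> e') # v) = a # (\<not> b) # r"
        unfolding act_Cons_psec[of ?g] using g by (auto simp del: act.simps)
      then show ?thesis using inv[of ?g "c # e' # u" "c # (\<not> e') # v"] below by simp
    qed
    show ?thesis
    proof (cases "e = f")
      case True
      then show ?thesis unfolding xe ye
        using R[OF len(1) lr] R[OF len(2) lr] trans by blast
    next
      case False
      then have "f = (\<not> e)" by auto
      then show ?thesis unfolding xe ye using R[OF len] by simp
    qed
  qed
qed

text \<open>Each half carries an even number of labels, so they can be removed two at a time by
  pairs inside that half.\<close>

lemma balanced_subset:
  assumes B0: "pone \<in> B" and Bx: "\<And>l m. l \<in> B \<Longrightarrow> m \<in> B \<Longrightarrow> pxor l m \<in> B"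
    and pairs: "\<And>x y. length x = n \<Longrightarrow> length y = n \<Longrightarrow> hd x = hd y \<Longrightarrow> pair x y \<in> B"
    and n: "1 \<le> n"
  shows "balanced n \<subseteq> B"
proof
  fix l assume "l \<in> balanced n"
  then show "l \<in> B"
  proof (induction "card {w. l w}" arbitrary: l rule: less_induct)
    case less
    have lev: "length w = n" if "l w" for w
      using less.prems that by (auto simp: balanced_def kernel_FP)
    have fin: "finite {w. l w}" by (rule finite_subset[OF _ finite_words[of n]]) (auto simp: lev)
    show ?case
    proof (cases "l = pone")
      case True
      then show ?thesis using B0 by simp
    next
      case False
      then obtain u where u: "l u" by (auto simp: eq_pone_iff)
      \<comment> \<open>If \<open>u\<close> were the only label in its half, the parity there would
        be 1.\<close>
      have "\<exists>v. v \<noteq> u \<and> l v \<and> hd v = hd u"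
      proof (rule ccontr)
        assume no: "\<not> (\<exists>v. v \<noteq> u \<and> l v \<and> hd v = hd u)"
        have "half_parity n l (hd u) = parity {w. length w = n} half_weight (\<lambda>w. w = u) (hd u)"
          unfolding half_parity_def parity_def
          using no u by (intro sum.cong) (auto simp: half_weight_def)
        also have "\<dots> = 1"
          using lev[OF u] n by (subst parity_single) (auto simp: finite_words half_weight_def)
        finally show False using less.prems by (simp add: balanced_def)
      qed
      then obtain v where v: "v \<noteq> u" "l v" "hd v = hd u" by blast
      let ?p = "pair u v"
      have sub: "{w. pxor l ?p w} = {w. l w} - {u, v}"
        using u v by (auto simp: pxor_def pair_def)
      have "card {w. pxor l ?p w} < card {w. l w}"
        unfolding sub using fin u by (intro psubset_card_mono) auto
      moreover have "pxor l ?p \<in> balanced n"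
      proof -
        have p: "?p = pxor (\<lambda>w. w = u) (\<lambda>w. w = v)" by (simp add: pair_def pxor_def)
        have "half_parity n ?p i = 0" for i
          unfolding p half_parity_def parity_pxor
          using lev[OF u] lev[OF v(2)] v(3) n
          by (auto simp: parity_single finite_words half_weight_def bit_add_eq_0_iff)
        then have "half_parity n (pxor l ?p) i = 0" for i
          using less.prems by (simp add: half_parity_def parity_pxor balanced_def)
        moreover have "length w = n" if "pxor l ?p w" for w
          using that sub lev by blast
        ultimately show ?thesis by (simp add: balanced_def kernel_FP)
      qed
      ultimately have "pxor l ?p \<in> B" using less.hyps by blast
      then have "pxor (pxor l ?p) ?p \<in> B"
        using Bx pairs lev[OF u] lev[OF v(2)] v(3) by metis
      then show ?thesis by simp
    qed
  qed
qed

lemma kernel_eq_balanced: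
  assumes n: "1 \<le> n" and S: "portrait_group (Suc n) S" and full: "trunc n ` S = FP n"
    and card: "card (pkernel n S) = 2 ^ (2 ^ n - 2)"
  shows "pkernel n S = balanced n"
proof -
  have "balanced n \<subseteq> pkernel n S"
    by (rule balanced_subset[OF pone_in_kernel[OF S] kernel_pxor[OF S] pair_in_kernel[OF S full card] n])
  then show ?thesis
    using card card_balanced[OF n] finite_kernel[OF S, of n] card_subset_eq by metis
qed

section \<open>Classification\<close>

context
  fixes n :: nat and S :: "portrait set"
  assumes n: "1 \<le> n" and S: "portrait_group (Suc n) S" and full: "trunc n ` S = FP n"
    and kernel: "pkernel n S = balanced n"
begin

lemma half_parity_kernel:
  assumes "p \<in> S" "trunc n p = pone"
  shows "half_parity n p i = 0"
proof -
  have "p \<in> balanced n" using assms kernel by (auto simp: pkernel_def)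
  then show ?thesis by (simp add: balanced_def)
qed

text \<open>The two elements differ by a kernel element, whose half parities vanish. On
  \<open>S\<close> the half parity is therefore a function of the truncation.\<close>

lemma half_parity_eqI:
  assumes "p \<in> S" "q \<in> S" "trunc n p = trunc n q"
  shows "half_parity n p i = half_parity n q i"
proof -
  obtain k where k: "k \<in> S" "pmul p k = pone" "pmul k p = pone"
    using portrait_group_inverse[OF S assms(1)] .
  have "trunc n (pmul k q) = trunc n (pmul k p)" by (simp add: trunc_pmul assms(3))
  then have t: "trunc n (pmul k q) = pone" by (simp add: k)
  have "pmul k q \<in> S" using k(1) assms(2) portrait_groupD(3)[OF S] by blast
  then have "half_parity n (pmul k q) j = 0" for j using t by (rule half_parity_kernel)
  moreover have "q = pmul p (pmul k q)" using k by (simp flip: pmul_assoc)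
  moreover have "\<not> pmul k q []"
    using n t kernel_root[of "n - 1"] by simp
  ultimately show ?thesis using half_parity_pmul[of n p "pmul k q" i] by simp
qed

lemma swap_lift:
  assumes "length v < n"
  obtains q where "q \<in> S" "trunc n q = (\<lambda>w. w = v)"
proof -
  have "(\<lambda>w. w = v) \<in> trunc n ` S" unfolding full using assms by (simp add: FP_def)
  then show ?thesis using that by (metis imageE)
qed

text \<open>The square of a lift lies in the kernel, and since the root swap exchanges the halves,
  each half parity of the square is the sum of the two half parities of the lift.\<close>

lemma half_parity_root_swap:
  assumes "q \<in> S" "trunc n q = (\<lambda>w. w = [])"
  shows "half_parity n q i = half_parity n q j"
proof -
  have "trunc n (pmul q q) = pone" unfolding trunc_pmul assms(2)
  proof (rule ext)
    fix w :: word
    have "act (\<lambda>w. w = []) w = [] \<longleftrightarrow> w = []" by (cases w) auto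
    then show "pmul (\<lambda>w. w = []) (\<lambda>w. w = []) w = pone w" by (simp add: pmul_def)
  qed
  then have "half_parity n (pmul q q) i = 0"
    using assms(1) portrait_groupD(3)[OF S] by (intro half_parity_kernel)
  moreover have "q []" using fun_cong[OF assms(2), of "[]"] by (simp add: trunc_def)
  ultimately have "half_parity n q i = half_parity n q (\<not> i)"
    by (simp add: half_parity_pmul bit_add_eq_0_iff)
  then show ?thesis by (cases i; cases j) simp_all
qed

text \<open>Conjugating the swap at \<open>v\<close> by \<open>h\<close> gives the swap at the image
  of \<open>v\<close>. The swap fixes all words of length up to \<open>length v\<close>, so it moves
  no label of \<open>h\<close>.\<close>

lemma pmul_swap_commute:
  assumes "h \<in> FP (length v)"
  shows "pmul h (\<lambda>w. w = v) = pmul (\<lambda>w. w = act h v) h"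
proof (rule ext)
  fix w
  have "h (act (\<lambda>w. w = v) w) = h w"
  proof (cases "length w \<le> length v")
    case True
    then have "act (\<lambda>w. w = v) w = act pone w" by (intro act_cong) auto
    then show ?thesis by simp
  next
    case False
    then show ?thesis using assms by (auto simp: FP_def)
  qed
  then show "pmul h (\<lambda>w. w = v) w = pmul (\<lambda>w. w = act h v) h w" by (auto simp: pmul_def)
qed

text \<open>Swaps on one level are conjugate by lifts \<open>H\<close> of portraits
  \<open>h\<close>. In the cocycle law the contributions of \<open>H\<close> cancel, and only the
  shift of the index by its root label remains.\<close>

lemma half_parity_swap:
  assumes u: "u \<in> S" "trunc n u = (\<lambda>w. w = replicate k False)" and k: "0 < k" "k < n"
    and q: "q \<in> S" "trunc n q = (\<lambda>w. w = v)" and v: "length v = k"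
  shows "half_parity n q i = half_parity n u (i \<noteq> hd v)"
proof -
  let ?o = "replicate k False"
  obtain h where h: "h \<in> FP k" "act h ?o = v" using act_transitive[of ?o v] v by auto
  have "h \<in> trunc n ` S" using h(1) k FP_mono[of k n] full by auto
  then obtain H where H: "H \<in> S" "trunc n H = h" by blast
  obtain m where k': "k = Suc m" using k by (cases k) auto
  \<comment> \<open>\<open>?o\<close> begins with 0, so the first letter of its image is the root
    label of \<open>h\<close>.\<close>
  have hd: "hd v = h []" using h(2) unfolding k' by auto
  have H0: "H [] = h []" using n by (simp add: H(2)[symmetric] trunc_def)
  have u0: "\<not> u []" using fun_cong[OF u(2), of "[]"] n k by (simp add: trunc_def)
  have "trunc n (pmul H u) = trunc n (pmul q H)"
    using pmul_swap_commute[of h ?o] h by (simp add: trunc_pmul H u q)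
  then have "half_parity n (pmul H u) j = half_parity n (pmul q H) j" for j
    using H(1) u(1) q(1) portrait_groupD(3)[OF S] by (intro half_parity_eqI)
  then have "half_parity n u j + half_parity n H j = half_parity n H j + half_parity n q (j \<noteq> h [])" for j
    by (simp add: half_parity_pmul u0 H0)
  then have "half_parity n u j = half_parity n q (j \<noteq> h [])" for j
    by (simp add: add.commute)
  from this[of "i \<noteq> h []"] show ?thesis by (cases i; cases "h []") (simp_all add: hd)
qed

text \<open>The parameters are read off from lifts of single swaps. The cocycle law propagates the
  vanishing of the defect from these lifts to all of \<open>S\<close>, and equal orders turn the
  inclusion into equality.\<close>

lemma ex_defect_group: "\<exists>\<theta>\<in>Pow (params n). S = defect_group n \<theta>"
proof -
  have "\<exists>q. q \<in> S \<and> trunc n q = (\<lambda>w. w = v)" if "length v < n" for v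
    using swap_lift[OF that] by blast
  then obtain s where s: "\<And>v. length v < n \<Longrightarrow> s v \<in> S \<and> trunc n (s v) = (\<lambda>w. w = v)"
    by metis
  \<comment> \<open>The leftmost word represents its level: its first letter is 0, so
    \<open>b\<close> is the relative half.\<close>
  define \<theta> where "\<theta> = {(k, b) \<in> params n. half_parity n (s (replicate k False)) b = 1}"
  have par: "half_parity n q i = of_bool (weight n \<theta> v i)"
    if q: "q \<in> S" "trunc n q = (\<lambda>w. w = v)" and v: "length v < n" for q v i
  proof (cases "v = []")
    case True
    have "half_parity n q i = half_parity n (s []) False"
      using half_parity_root_swap[of q i False] half_parity_eqI[of q "s []"] q s[of "[]"] True n by auto
    then show ?thesis using True by (simp add: weight_def \<theta>_def params_def of_bool_eq_1_bit)
  next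
    case False
    then have "half_parity n q i = half_parity n (s (replicate (length v) False)) (i \<noteq> hd v)"
      using s[of "replicate (length v) False"] v q by (intro half_parity_swap) auto
    moreover have "(length v, i \<noteq> hd v) \<in> params n" using False v by (cases v) (auto simp: params_def)
    ultimately show ?thesis using False v by (simp add: weight_def \<theta>_def of_bool_eq_1_bit)
  qed
  have defect_swap: "defect n \<theta> (s v) i = 0" if "length v < n" for v i
    using s[OF that] that par[of "s v" v i]
    by (simp add: defect_trunc_single[OF n] bit_add_eq_0_iff)
  text \<open>Left multiplication by a lift of the swap at \<open>act p w\<close> flips just the label of \<open>p\<close> at \<open>w\<close>
    (up to the last level), so induction on the number of labels below level \<open>n\<close> applies.\<close>
  have "defect n \<theta> p i = 0" if "p \<in> S" for p i
    using that
  proof (induction "card {w. trunc n p w}" arbitrary: p i rule: less_induct)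
    case less
    show ?case
    proof (cases "trunc n p = pone")
      case True
      then show ?thesis using half_parity_kernel[OF less.prems] by (simp add: defect_kernel[OF n])
    next
      case False
      then obtain w where w: "trunc n p w" by (auto simp: eq_pone_iff)
      then have wn: "length w < n" by (simp add: trunc_def)
      let ?t = "s (act p w)"
      have t: "?t \<in> S" "trunc n ?t = (\<lambda>v. v = act p w)" using s[of "act p w"] wn by auto
      have "trunc n (pmul ?t p) v \<longleftrightarrow> trunc n p v \<and> v \<noteq> w" for v
      proof (cases "length v < n")
        case True
        have "?t (act p v) = trunc n ?t (act p v)" using True by (simp add: trunc_def)
        also have "\<dots> \<longleftrightarrow> v = w" by (simp add: t(2))
        finally show ?thesis using True w by (auto simp: trunc_def pmul_def)
      qed (simp add: trunc_def)
      then have sub: "{v. trunc n (pmul ?t p) v} = {v. trunc n p v} - {w}" by auto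
      have "finite {v. trunc n p v}"
        by (rule finite_subset[OF _ finite_words_less[of n]]) (auto simp: trunc_def)
      then have "card {v. trunc n (pmul ?t p) v} < card {v. trunc n p v}"
        unfolding sub using w by (intro psubset_card_mono) auto
      moreover have "pmul ?t p \<in> S" using t(1) less.prems portrait_groupD(3)[OF S] by blast
      ultimately have "defect n \<theta> (pmul ?t p) i = 0" by (rule less.hyps)
      then show ?thesis using defect_swap[of "act p w"] wn by (simp add: defect_pmul)
    qed
  qed
  then have "S \<subseteq> defect_group n \<theta>" using portrait_groupD(1)[OF S] by (auto simp: defect_group_def)
  \<comment> \<open>Both groups truncate onto \<open>FP n\<close> with kernel
    \<open>balanced n\<close>.\<close>
  moreover have "card S = card (defect_group n \<theta>)"
    using card_trunc_image[OF S, of n] card_trunc_image[OF portrait_group_defect_group, of n \<theta> n]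
    by (simp add: full kernel trunc_defect_group[OF n] kernel_defect_group[OF n])
  ultimately have "S = defect_group n \<theta>"
    using portrait_groupD(4)[OF portrait_group_defect_group] by (intro card_subset_eq)
  moreover have "\<theta> \<in> Pow (params n)" by (auto simp: \<theta>_def)
  ultimately show ?thesis by blast
qed

end

section \<open>Minimality of the pattern size and the count\<close>

lemma trunc_image_FP:
  assumes "FP n \<subseteq> L"
  shows "trunc n ` L = FP n"
proof (intro equalityI subsetI)
  fix l assume l: "l \<in> FP n"
  then have "l = trunc n l" by (simp add: trunc_FP)
  then show "l \<in> trunc n ` L" using assms l by blast
qed auto

lemma constrained_FP: "constrained d (FP d) = UNIV"
  by (simp add: constrained_def)

text \<open>Up to level \<open>n\<close> the group looks like the full automorphism group, so
  patterns of size at most \<open>n\<close> would all be allowed and would define everything. This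
  contradicts index 4 in \<open>FP (Suc n)\<close>.\<close>

lemma defect_group_minimal:
  assumes n: "1 \<le> n" and T: "pattern_group d T"
    and eq: "constrained d T = constrained (Suc n) (defect_group n \<theta>)"
  shows "Suc n \<le> d"
proof (rule ccontr)
  assume "\<not> Suc n \<le> d"
  then have d: "d \<le> n" by simp
  note D = pattern_group_defect_group[OF n, of \<theta>]
  have "T = trunc d ` trunc (Suc n) ` constrained (Suc n) (defect_group n \<theta>)"
    using trunc_constrained[OF T] d by (simp add: eq trunc_image_trunc)
  also have "\<dots> = trunc d ` trunc n ` defect_group n \<theta>"
    using d by (simp add: trunc_constrained[OF D] trunc_image_trunc)
  also have "\<dots> = FP d"
    unfolding trunc_defect_group[OF n] by (rule trunc_image_FP[OF FP_mono[OF d]])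
  finally have "constrained (Suc n) (defect_group n \<theta>) = UNIV"
    using eq by (simp add: constrained_FP)
  then have "defect_group n \<theta> = FP (Suc n)"
    using trunc_constrained[OF D] trunc_image_FP[of "Suc n" UNIV] by (simp only: subset_UNIV)
  then have "4 * card (FP (Suc n)) = card (FP (Suc n))"
    using card_defect_group[OF n, of \<theta>] by (simp only:)
  then show False using card_portrait_group_pos[OF portrait_group_FP[of "Suc n"]] by linarith
qed

lemma finitely_constrained_classification:
  assumes n: "1 \<le> n"
  shows "{K. finitely_constrained K \<and> defined_by_patterns_of_size K (Suc n) \<and>
      hdim K = ereal (1 - 2 / (2::real) ^ n)} =
    (\<lambda>\<theta>. act ` constrained (Suc n) (defect_group n \<theta>)) ` Pow (params n)" (is "?L = ?R")
proof (intro equalityI subsetI)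
  fix K assume "K \<in> ?L"
  then have def: "defined_by_patterns_of_size K (Suc n)" and dim: "hdim K = ereal (1 - 2 / 2 ^ n)"
    by auto
  obtain S where S: "pattern_group (Suc n) S" and K: "K = act ` constrained (Suc n) S"
    using def finitely_constrained_size_iff[of "Suc n" K] by (auto simp: defined_by_patterns_of_size_def)
  have card: "card (pkernel n S) = 2 ^ (2 ^ n - 2)"
    using hdim_constrained_iff[OF S] dim n by (simp add: K)
  obtain m where m: "n = Suc m" using n by (cases n) auto
  have "trunc n ` S = FP n"
  proof (rule ccontr)
    \<comment> \<open>Otherwise patterns of size \<open>n\<close> already define \<open>K\<close>,
      against minimality.\<close>
    assume "trunc n ` S \<noteq> FP n"
    then have "K = act ` constrained n (trunc n ` S)"
      using trunc_full_or_not_minimal[of m S] S card by (simp add: K m)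
    moreover have "pattern_group n (trunc n ` S)" using pattern_group_trunc[of m S] S by (simp add: m)
    ultimately have "\<exists>P. essential_pattern_group n P \<and> K = G_P n P"
      using finitely_constrained_size_iff[of n K] by blast
    then have "Suc n \<le> n" using def unfolding defined_by_patterns_of_size_def by blast
    then show False by simp
  qed
  then have "\<exists>\<theta>\<in>Pow (params n). S = defect_group n \<theta>"
    using n pattern_groupD(2)[OF S] kernel_eq_balanced[OF n _ _ card] by (intro ex_defect_group)
  then show "K \<in> ?R" unfolding K by blast
next
  fix K assume "K \<in> ?R"
  then obtain \<theta> where K: "K = act ` constrained (Suc n) (defect_group n \<theta>)" by blast
  note D = pattern_group_defect_group[OF n, of \<theta>]
  have ex: "\<exists>P. essential_pattern_group (Suc n) P \<and> K = G_P (Suc n) P"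
    using finitely_constrained_size_iff[of "Suc n" K] D K by blast
  have "Suc n \<le> d" if P: "essential_pattern_group d P" "K = G_P d P" for d P
  proof -
    obtain T where T: "pattern_group d T" "K = act ` constrained d T"
      using finitely_constrained_size_iff[of d K] P by blast
    have "constrained d T = constrained (Suc n) (defect_group n \<theta>)"
      using T(2) K by (simp add: inj_image_eq_iff[OF inj_portrait_act])
    then show ?thesis by (rule defect_group_minimal[OF n T(1)])
  qed
  moreover have "hdim K = ereal (1 - 2 / 2 ^ n)"
    using hdim_constrained_iff[OF D] n card_balanced[OF n] by (simp add: K kernel_defect_group[OF n])
  ultimately show "K \<in> ?L"
    using ex by (auto simp: defined_by_patterns_of_size_def finitely_constrained_def)
qed

theorem theorem4:
  fixes d :: nat
  assumes "d \<ge> 2"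
  shows "card {K. finitely_constrained K \<and> defined_by_patterns_of_size K d \<and>
                  hdim K = ereal (1 - 2 / (2::real) ^ (d - 1))} = 2 ^ (2 * d - 3)"
proof -
  define n where "n = d - 1"
  have n: "1 \<le> n" and d: "d = Suc n" using assms by (auto simp: n_def)
  have "inj_on (\<lambda>\<theta>. act ` constrained (Suc n) (defect_group n \<theta>)) (Pow (params n))"
  proof (rule inj_onI)
    fix \<theta> \<theta>' assume \<theta>: "\<theta> \<in> Pow (params n)" "\<theta>' \<in> Pow (params n)"
      and "act ` constrained (Suc n) (defect_group n \<theta>) = act ` constrained (Suc n) (defect_group n \<theta>')"
    then have "constrained (Suc n) (defect_group n \<theta>) = constrained (Suc n) (defect_group n \<theta>')"
      by (simp add: inj_image_eq_iff[OF inj_portrait_act])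
    \<comment> \<open>Truncating the constrained group to size \<open>Suc n\<close> gives back its
      pattern group.\<close>
    then have "defect_group n \<theta> = defect_group n \<theta>'"
      using trunc_constrained[OF pattern_group_defect_group[OF n]] by metis
    then show "\<theta> = \<theta>'" using inj_on_defect_group[OF n] \<theta> by (auto dest: inj_onD)
  qed
  moreover have "finite (params n)" by (simp add: params_def)
  ultimately have "card ((\<lambda>\<theta>. act ` constrained (Suc n) (defect_group n \<theta>)) ` Pow (params n)) = 2 ^ (2 * n - 1)"
    by (simp add: card_image card_Pow card_params[OF n])
  then show ?thesis using finitely_constrained_classification[OF n] by (simp add: d)
qed

end
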